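(* Let $\Sigma\subset H_1$ be a $p$-minimal surface. Then, in terms of a normal coordinate system $(x,y)$, the $\alpha$-function and the induced metric coefficients $a,b$ can be normalized to the following normal forms: 1. $\alpha=\frac{1}{x+\zeta_1(y)}$, $a=0$, $b=\frac{\alpha^2}{\sqrt{1+\alpha^2}}$, if $\Sigma$ is of special type I; 2. $\alpha=\frac{1}{2x+\zeta_1(y)}$, $a=0$, $b=\frac{|\alpha|}{\sqrt{1+\alpha^2}}$, if $\Sigma$ is of special type II; 3. $\alpha=\frac{x+\zeta_1(y)}{(x+\zeta_1(y))^2+\zeta_2(y)}$, $a=0$, $b=\frac{|\alpha|}{|x+\zeta_1(y)|\sqrt{1+\alpha^2}}$, if $\Sigma$ is of general type; for some functions $\zeta_1(y)$ and $\zeta_2(y)$. Here $\zeta_2(y)$ is unique up to a translation on $y$, and $\zeta_1(y)$ is unique up to a translation on $y$ as well as a translation on its image (i.e. addition of a constant).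
   Context: The Heisenberg group $H_1$ is $\mathbb{R}^3$ with the group law $(x_1,y_1,z_1)\circ(x_2,y_2,z_2)=(x_1+x_2,\,y_1+y_2,\,z_1+z_2+y_1x_2-x_1y_2)$. Left invariant fields: $\mathring e_1=\partial_x+y\partial_z$, $\mathring e_2=\partial_y-x\partial_z$, $T=\partial_z$. Contact form $\Theta=dz+x\,dy-y\,dx$, contact bundle $\xi=\ker\Theta$, $J\mathring e_1=\mathring e_2$, $J\mathring e_2=-\mathring e_1$. The adapted metric makes $\mathring e_1,\mathring e_2,T$ orthonormal; $\nabla$ is the connection for which they are parallel. All objects are $C^\infty$. For a surface $\Sigma\subset H_1$, a point is singular if $T_p\Sigma=\xi_p$, otherwise regular. On the regular part choose a unit field $e_1\in T\Sigma\cap\xi$ (characteristic direction, determined up to sign), $e_2=Je_1$; the $p$-mean curvature $H$ is defined by $\nabla_{e_1}e_2=-He_1$; $\Sigma$ is $p$-minimal if $H=0$ on the regular part. The $\alpha$-function is defined by $\alpha e_2+T\in T\Sigma$; put $\hat e_1=e_1$, $\hat e_2=\frac{\alpha e_2+T}{\sqrt{1+\alpha^2}}$, an orthonormal frame of $T\Sigma$. A compatible coordinate system is one with $e_1=\partial_x$; then $\hat e_2=a\,\partial_x+b\,\partial_y$, with coordinates taken so that $b>0$; $a,b$ represent the induced metric. Types (local, in compatible coordinates, no singular points): special type I if $\alpha=\frac1{x+c_1(y)}$; special type II if $\alpha=\frac1{2x+c_1(y)}$; general type if $\alpha=\frac{x+c_1(y)}{(x+c_1(y))^2+c_2(y)}$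 with $c_2(y)\ne0$ for all $y$; for some functions $c_1,c_2$ of $y$. An orthogonal coordinate system is a compatible one with $a=0$. A normal coordinate system is an orthogonal one in which $b$ is moreover normalized to the form $b=\frac{\alpha^2}{\sqrt{1+\alpha^2}}$ (special type I), $b=\frac{|\alpha|}{\sqrt{1+\alpha^2}}$ (special type II), $b=\frac{|\alpha|}{|x+c_1(y)|\sqrt{1+\alpha^2}}$ (general type; the quotient $|\alpha|/|x+c_1(y)|$ is understood as $1/|(x+c_1(y))^2+c_2(y)|$ where $x+c_1(y)=0$). The theorem asserts that such coordinates exist locally around every point of a surface with type; the uniqueness is with respect to the choice of normal coordinates (for a fixed characteristic direction $e_1$, on connected neighborhoods). *)

theory Defs
  imports "HOL-Analysis.Analysis"
begin

section \<open>Smooth maps\<close>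

text \<open>\<open>Cn_on\<close> and \<open>smooth_on\<close> are meant for open subsets of Euclidean spaces; \<open>smooth_along\<close>, by
  local smooth extension, for arbitrary subsets such as surfaces.\<close>

primrec Cn_on :: "nat \<Rightarrow> 'a::real_normed_vector set \<Rightarrow> ('a \<Rightarrow> 'b::real_normed_vector) \<Rightarrow> bool" where
  "Cn_on 0 S f \<longleftrightarrow> continuous_on S f"
| "Cn_on (Suc n) S f \<longleftrightarrow> (\<forall>x\<in>S. f differentiable (at x)) \<and>
     (\<forall>v. Cn_on n S (\<lambda>x. frechet_derivative f (at x) v))"

definition smooth_on :: "'a::real_normed_vector set \<Rightarrow> ('a \<Rightarrow> 'b::real_normed_vector) \<Rightarrow> bool" where
  "smooth_on S f \<longleftrightarrow> (\<forall>n. Cn_on n S f)"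

definition smooth_along :: "'a::real_normed_vector set \<Rightarrow> ('a \<Rightarrow> 'b::real_normed_vector) \<Rightarrow> bool" where
  "smooth_along W f \<longleftrightarrow> (\<forall>p\<in>W. \<exists>V F. open V \<and> p \<in> V \<and> smooth_on V F \<and> (\<forall>q\<in>W \<inter> V. F q = f q))"


section \<open>The Heisenberg group\<close>

text \<open>Points and tangent vectors of the Heisenberg group are both represented by their
  coordinates in \<open>\<real>\<^sup>3\<close>.\<close>

type_synonym heis = "real \<times> real \<times> real"

fun heis_mult :: "heis \<Rightarrow> heis \<Rightarrow> heis" where
  "heis_mult (x1, y1, z1) (x2, y2, z2) = (x1 + x2, y1 + y2, z1 + z2 + y1 * x2 - x1 * y2)"

fun E1 :: "heis \<Rightarrow> heis" where "E1 (x, y, z) = (1, 0, y)"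

fun E2 :: "heis \<Rightarrow> heis" where "E2 (x, y, z) = (0, 1, - x)"

definition Reeb :: heis where "Reeb = (0, 0, 1)"

fun contact_form :: "heis \<Rightarrow> heis \<Rightarrow> real" where
  "contact_form (x, y, z) (u, v, w) = w + x * v - y * u"

definition contact_plane :: "heis \<Rightarrow> heis set" where
  "contact_plane p = {v. contact_form p v = 0}"

text \<open>The components of a vector with respect to the frame \<open>E1, E2, Reeb\<close> at \<open>p\<close>.\<close>

fun frame_coords :: "heis \<Rightarrow> heis \<Rightarrow> heis" where
  "frame_coords p (u, v, w) = (u, v, contact_form p (u, v, w))"

fun of_frame_coords :: "heis \<Rightarrow> heis \<Rightarrow> heis" where
  "of_frame_coords p (c1, c2, c3) = c1 *\<^sub>R E1 p + c2 *\<^sub>R E2 p + c3 *\<^sub>R Reeb"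

text \<open>The adapted metric is the one for which the frame is orthonormal; \<open>\<bullet>\<close> is the
  Euclidean inner product of the components.\<close>

definition adapted_metric :: "heis \<Rightarrow> heis \<Rightarrow> heis \<Rightarrow> real" where
  "adapted_metric p v w = frame_coords p v \<bullet> frame_coords p w"

text \<open>\<open>J\<close> is only meaningful on the contact plane; as a total function it is extended by
  \<open>J p Reeb = 0\<close>.\<close>

fun J :: "heis \<Rightarrow> heis \<Rightarrow> heis" where
  "J p (u, v, w) = u *\<^sub>R E2 p - v *\<^sub>R E1 p"

lemma left_invariant_frame:
  "((\<lambda>t. heis_mult p (t, 0, 0)) has_vector_derivative E1 p) (at 0)"
  "((\<lambda>t. heis_mult p (0, t, 0)) has_vector_derivative E2 p) (at 0)"
  "((\<lambda>t. heis_mult p (0, 0, t)) has_vector_derivative Reeb) (at 0)"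
  by (cases p; auto simp: Reeb_def intro!: derivative_eq_intros has_vector_derivative_Pair)+

lemma of_frame_coords_frame_coords [simp]:
  "of_frame_coords p (frame_coords p v) = v" "frame_coords p (of_frame_coords p c) = c"
  by (cases p; cases v; cases c; simp add: Reeb_def)+

lemma frame_orthonormal:
  "adapted_metric p (E1 p) (E1 p) = 1" "adapted_metric p (E2 p) (E2 p) = 1"
  "adapted_metric p Reeb Reeb = 1" "adapted_metric p (E1 p) (E2 p) = 0"
  "adapted_metric p (E1 p) Reeb = 0" "adapted_metric p (E2 p) Reeb = 0"
  by (cases p; simp add: adapted_metric_def Reeb_def)+

lemma J_frame: "J p (E1 p) = E2 p" "J p (E2 p) = - E1 p"
  by (cases p; simp)+

lemma contact_form_frame:
  "contact_form p (E1 p) = 0" "contact_form p (E2 p) = 0" "contact_form p Reeb = 1"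
  by (cases p; simp add: Reeb_def)+


section \<open>Surfaces\<close>

definition surface_patch :: "heis set \<Rightarrow> (real \<times> real) set \<Rightarrow> (real \<times> real \<Rightarrow> heis) \<Rightarrow> bool" where
  "surface_patch \<Sigma> U \<phi> \<longleftrightarrow> open U \<and> smooth_on U \<phi> \<and>
     (\<forall>u\<in>U. inj (frechet_derivative \<phi> (at u))) \<and>
     openin (top_of_set \<Sigma>) (\<phi> ` U) \<and> (\<exists>\<psi>. homeomorphism U (\<phi> ` U) \<phi> \<psi>)"

definition surface :: "heis set \<Rightarrow> bool" where
  "surface \<Sigma> \<longleftrightarrow> (\<forall>p\<in>\<Sigma>. \<exists>U \<phi>. surface_patch \<Sigma> U \<phi> \<and> p \<in> \<phi> ` U)"

definition tangent_plane :: "heis set \<Rightarrow> heis \<Rightarrow> heis set" where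
  "tangent_plane \<Sigma> p = {v. \<exists>\<epsilon>>0. \<exists>\<gamma>. smooth_on {-\<epsilon><..<\<epsilon>} \<gamma> \<and> \<gamma> ` {-\<epsilon><..<\<epsilon>} \<subseteq> \<Sigma> \<and>
     \<gamma> 0 = p \<and> (\<gamma> has_vector_derivative v) (at 0)}"

definition singular_point :: "heis set \<Rightarrow> heis \<Rightarrow> bool" where
  "singular_point \<Sigma> p \<longleftrightarrow> p \<in> \<Sigma> \<and> tangent_plane \<Sigma> p = contact_plane p"

definition characteristic_field :: "heis set \<Rightarrow> heis set \<Rightarrow> (heis \<Rightarrow> heis) \<Rightarrow> bool" where
  "characteristic_field \<Sigma> W e\<^sub>1 \<longleftrightarrow> openin (top_of_set \<Sigma>) W \<and> smooth_along W e\<^sub>1 \<and>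
     (\<forall>p\<in>W. \<not> singular_point \<Sigma> p \<and> e\<^sub>1 p \<in> tangent_plane \<Sigma> p \<inter> contact_plane p \<and>
        adapted_metric p (e\<^sub>1 p) (e\<^sub>1 p) = 1)"

text \<open>\<open>nabla_within \<Sigma> V p v w\<close> says \<open>\<nabla>\<^sub>v V = w\<close> at \<open>p\<close> for a vector field \<open>V\<close> defined along \<open>\<Sigma>\<close>
  only: as the frame is parallel, its components are differentiated. The derivative \<open>D\<close> within
  \<open>\<Sigma>\<close> is not unique as a linear map on \<open>\<real>\<^sup>3\<close>, but its values on \<open>tangent_plane \<Sigma> p\<close> are, so
  this is meaningful for tangential \<open>v\<close>.\<close>

definition nabla_within :: "heis set \<Rightarrow> (heis \<Rightarrow> heis) \<Rightarrow> heis \<Rightarrow> heis \<Rightarrow> heis \<Rightarrow> bool" where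
  "nabla_within \<Sigma> V p v w \<longleftrightarrow>
     (\<exists>D. ((\<lambda>q. frame_coords q (V q)) has_derivative D) (at p within \<Sigma>) \<and>
          w = of_frame_coords p (D v))"

definition has_p_mean_curvature :: "heis set \<Rightarrow> (heis \<Rightarrow> heis) \<Rightarrow> heis \<Rightarrow> real \<Rightarrow> bool" where
  "has_p_mean_curvature \<Sigma> e\<^sub>1 p H \<longleftrightarrow>
     nabla_within \<Sigma> (\<lambda>q. J q (e\<^sub>1 q)) p (e\<^sub>1 p) (- H *\<^sub>R e\<^sub>1 p)"

definition p_minimal :: "heis set \<Rightarrow> bool" where
  "p_minimal \<Sigma> \<longleftrightarrow> surface \<Sigma> \<and>
     (\<forall>W e\<^sub>1. characteristic_field \<Sigma> W e\<^sub>1 \<longrightarrow> (\<forall>p\<in>W. has_p_mean_curvature \<Sigma> e\<^sub>1 p 0))"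

definition alpha :: "heis set \<Rightarrow> (heis \<Rightarrow> heis) \<Rightarrow> heis \<Rightarrow> real" where
  "alpha \<Sigma> e\<^sub>1 p = (THE r. r *\<^sub>R J p (e\<^sub>1 p) + Reeb \<in> tangent_plane \<Sigma> p)"

definition e2_hat :: "heis set \<Rightarrow> (heis \<Rightarrow> heis) \<Rightarrow> heis \<Rightarrow> heis" where
  "e2_hat \<Sigma> e\<^sub>1 p =
     (alpha \<Sigma> e\<^sub>1 p *\<^sub>R J p (e\<^sub>1 p) + Reeb) /\<^sub>R sqrt (1 + (alpha \<Sigma> e\<^sub>1 p)\<^sup>2)"


section \<open>Compatible coordinates and types\<close>

text \<open>A coordinate system is represented by the inverse \<open>\<phi>\<close> of the coordinate map, so \<open>\<partial>\<^sub>x\<close> and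
  \<open>\<partial>\<^sub>y\<close> are the partial derivatives of \<open>\<phi>\<close>. The functions \<open>a\<close>, \<open>b\<close>, \<open>c\<^sub>1\<close>, \<open>c\<^sub>2\<close> matter only on \<open>U\<close>,
  respectively on its projection to the \<open>y\<close>-axis.\<close>

definition compatible_coords ::
  "heis set \<Rightarrow> (heis \<Rightarrow> heis) \<Rightarrow> (real \<times> real) set \<Rightarrow> (real \<times> real \<Rightarrow> heis) \<Rightarrow>
   (real \<times> real \<Rightarrow> real) \<Rightarrow> (real \<times> real \<Rightarrow> real) \<Rightarrow> bool" where
  "compatible_coords \<Sigma> e\<^sub>1 U \<phi> a b \<longleftrightarrow>
     surface_patch \<Sigma> U \<phi> \<and> characteristic_field \<Sigma> (\<phi> ` U) e\<^sub>1 \<and>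
     (\<forall>u\<in>U. e\<^sub>1 (\<phi> u) = frechet_derivative \<phi> (at u) (1, 0) \<and>
        e2_hat \<Sigma> e\<^sub>1 (\<phi> u) =
          a u *\<^sub>R frechet_derivative \<phi> (at u) (1, 0) + b u *\<^sub>R frechet_derivative \<phi> (at u) (0, 1) \<and>
        b u > 0)"

definition orthogonal_coords ::
  "heis set \<Rightarrow> (heis \<Rightarrow> heis) \<Rightarrow> (real \<times> real) set \<Rightarrow> (real \<times> real \<Rightarrow> heis) \<Rightarrow>
   (real \<times> real \<Rightarrow> real) \<Rightarrow> (real \<times> real \<Rightarrow> real) \<Rightarrow> bool" where
  "orthogonal_coords \<Sigma> e\<^sub>1 U \<phi> a b \<longleftrightarrow> compatible_coords \<Sigma> e\<^sub>1 U \<phi> a b \<and> (\<forall>u\<in>U. a u = 0)"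

text \<open>The inequations guard against \<open>r / 0 = 0\<close>.\<close>

definition type_I_form :: "(real \<times> real) set \<Rightarrow> (real \<times> real \<Rightarrow> real) \<Rightarrow> (real \<Rightarrow> real) \<Rightarrow> bool" where
  "type_I_form U \<alpha> c\<^sub>1 \<longleftrightarrow> smooth_on (snd ` U) c\<^sub>1 \<and>
     (\<forall>(x, y)\<in>U. x + c\<^sub>1 y \<noteq> 0 \<and> \<alpha> (x, y) = 1 / (x + c\<^sub>1 y))"

definition type_II_form :: "(real \<times> real) set \<Rightarrow> (real \<times> real \<Rightarrow> real) \<Rightarrow> (real \<Rightarrow> real) \<Rightarrow> bool" where
  "type_II_form U \<alpha> c\<^sub>1 \<longleftrightarrow> smooth_on (snd ` U) c\<^sub>1 \<and>
     (\<forall>(x, y)\<in>U. 2 * x + c\<^sub>1 y \<noteq> 0 \<and> \<alpha> (x, y) = 1 / (2 * x + c\<^sub>1 y))"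

definition general_type_form ::
  "(real \<times> real) set \<Rightarrow> (real \<times> real \<Rightarrow> real) \<Rightarrow> (real \<Rightarrow> real) \<Rightarrow> (real \<Rightarrow> real) \<Rightarrow> bool" where
  "general_type_form U \<alpha> c\<^sub>1 c\<^sub>2 \<longleftrightarrow> smooth_on (snd ` U) c\<^sub>1 \<and> smooth_on (snd ` U) c\<^sub>2 \<and>
     (\<forall>(x, y)\<in>U. c\<^sub>2 y \<noteq> 0 \<and> (x + c\<^sub>1 y)\<^sup>2 + c\<^sub>2 y \<noteq> 0 \<and>
        \<alpha> (x, y) = (x + c\<^sub>1 y) / ((x + c\<^sub>1 y)\<^sup>2 + c\<^sub>2 y))"

definition special_type_I :: "heis set \<Rightarrow> bool" where
  "special_type_I \<Sigma> \<longleftrightarrow> (\<forall>p\<in>\<Sigma>. \<exists>e\<^sub>1 U \<phi> a b c\<^sub>1. compatible_coords \<Sigma> e\<^sub>1 U \<phi> a b \<and> p \<in> \<phi> ` U \<and>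
     type_I_form U (alpha \<Sigma> e\<^sub>1 \<circ> \<phi>) c\<^sub>1)"

definition special_type_II :: "heis set \<Rightarrow> bool" where
  "special_type_II \<Sigma> \<longleftrightarrow> (\<forall>p\<in>\<Sigma>. \<exists>e\<^sub>1 U \<phi> a b c\<^sub>1. compatible_coords \<Sigma> e\<^sub>1 U \<phi> a b \<and> p \<in> \<phi> ` U \<and>
     type_II_form U (alpha \<Sigma> e\<^sub>1 \<circ> \<phi>) c\<^sub>1)"

definition general_type :: "heis set \<Rightarrow> bool" where
  "general_type \<Sigma> \<longleftrightarrow> (\<forall>p\<in>\<Sigma>. \<exists>e\<^sub>1 U \<phi> a b c\<^sub>1 c\<^sub>2. compatible_coords \<Sigma> e\<^sub>1 U \<phi> a b \<and> p \<in> \<phi> ` U \<and>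
     general_type_form U (alpha \<Sigma> e\<^sub>1 \<circ> \<phi>) c\<^sub>1 c\<^sub>2)"


section \<open>Normal coordinates\<close>

definition normal_coords_I ::
  "heis set \<Rightarrow> (heis \<Rightarrow> heis) \<Rightarrow> (real \<times> real) set \<Rightarrow> (real \<times> real \<Rightarrow> heis) \<Rightarrow>
   (real \<times> real \<Rightarrow> real) \<Rightarrow> (real \<times> real \<Rightarrow> real) \<Rightarrow> (real \<Rightarrow> real) \<Rightarrow> bool" where
  "normal_coords_I \<Sigma> e\<^sub>1 U \<phi> a b \<zeta>\<^sub>1 \<longleftrightarrow> orthogonal_coords \<Sigma> e\<^sub>1 U \<phi> a b \<and>
     (let \<alpha> = alpha \<Sigma> e\<^sub>1 \<circ> \<phi> in type_I_form U \<alpha> \<zeta>\<^sub>1 \<and>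
        (\<forall>u\<in>U. b u = (\<alpha> u)\<^sup>2 / sqrt (1 + (\<alpha> u)\<^sup>2)))"

definition normal_coords_II ::
  "heis set \<Rightarrow> (heis \<Rightarrow> heis) \<Rightarrow> (real \<times> real) set \<Rightarrow> (real \<times> real \<Rightarrow> heis) \<Rightarrow>
   (real \<times> real \<Rightarrow> real) \<Rightarrow> (real \<times> real \<Rightarrow> real) \<Rightarrow> (real \<Rightarrow> real) \<Rightarrow> bool" where
  "normal_coords_II \<Sigma> e\<^sub>1 U \<phi> a b \<zeta>\<^sub>1 \<longleftrightarrow> orthogonal_coords \<Sigma> e\<^sub>1 U \<phi> a b \<and>
     (let \<alpha> = alpha \<Sigma> e\<^sub>1 \<circ> \<phi> in type_II_form U \<alpha> \<zeta>\<^sub>1 \<and>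
        (\<forall>u\<in>U. b u = \<bar>\<alpha> u\<bar> / sqrt (1 + (\<alpha> u)\<^sup>2)))"

text \<open>Here \<open>\<bar>\<alpha>\<bar> / \<bar>x + \<zeta>\<^sub>1(y)\<bar>\<close> is continued to the points with \<open>x + \<zeta>\<^sub>1(y) = 0\<close>.\<close>

definition normal_coords_general ::
  "heis set \<Rightarrow> (heis \<Rightarrow> heis) \<Rightarrow> (real \<times> real) set \<Rightarrow> (real \<times> real \<Rightarrow> heis) \<Rightarrow>
   (real \<times> real \<Rightarrow> real) \<Rightarrow> (real \<times> real \<Rightarrow> real) \<Rightarrow> (real \<Rightarrow> real) \<Rightarrow> (real \<Rightarrow> real) \<Rightarrow> bool" where
  "normal_coords_general \<Sigma> e\<^sub>1 U \<phi> a b \<zeta>\<^sub>1 \<zeta>\<^sub>2 \<longleftrightarrow> orthogonal_coords \<Sigma> e\<^sub>1 U \<phi> a b \<and>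
     (let \<alpha> = alpha \<Sigma> e\<^sub>1 \<circ> \<phi> in general_type_form U \<alpha> \<zeta>\<^sub>1 \<zeta>\<^sub>2 \<and>
        (\<forall>(x, y)\<in>U. b (x, y) =
           (if x + \<zeta>\<^sub>1 y = 0 then 1 / \<bar>(x + \<zeta>\<^sub>1 y)\<^sup>2 + \<zeta>\<^sub>2 y\<bar>
            else \<bar>\<alpha> (x, y)\<bar> / \<bar>x + \<zeta>\<^sub>1 y\<bar>) / sqrt (1 + (\<alpha> (x, y))\<^sup>2)))"

end

(*
  In a compatible chart with e1 = d/dx put c = Theta(d/dy). The structure equation of the contact
  form and p-minimality give c_x = 2 alpha c, while the component of d/dy along e1, which governs the
  coefficient a, is independent of x since the characteristic curves are straight lines. In each of
  the three types the denominator of alpha (squared for special type I) is another solution q of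
  q_x = 2 alpha q, so c = d(y) q. Hence a change of coordinates (x + Gamma(y), Psi(y)) with
  Psi' = |d| and Gamma' the component of d/dy along e1 makes a vanish and turns
  b = 1 / (c sqrt (1 + alpha^2)) into the normal form.
  Conversely the transition map F between two normal charts has derivative diag(1, b'(F) / b). Equality
  of the alpha-functions forces b'(F) = b, so that F is a translation.
*)

theory Submission
  imports Defs
begin

section \<open>Calculus of smooth maps\<close>

text \<open>The characteristic field of the chart that witnesses the type may be the opposite of the
  prescribed one. Passing from \<open>e\<close> to \<open>- e\<close> changes the sign of \<alpha>
  but leaves the second frame vector alone, so a sign \<open>s\<close> in front of \<open>x\<close>
  absorbs the discrepancy. The square in special type I is forced: the denominator itself has
  logarithmic derivative \<alpha>, whereas 2 \<alpha> is required. The component of d/dy along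
  \<open>e\<close> is constant in \<open>x\<close> because d/dy changes along a ruling only by
  multiples of the \<open>y\<close>-derivative of the unit field, which is orthogonal to the field.
  A transition map is at first only a homeomorphism. It becomes differentiable as a continuous lift
  through an immersion, and the same argument identifies the tangent plane, defined by curves, with
  the image of the derivative of a chart. In the special types \<open>b\<close> is a function of
  \<alpha> alone, so \<open>b'(F) = b\<close> is immediate. In the general type \<open>b\<close>
  also involves \<zeta>1, and the values of \<alpha> along a characteristic segment must first be
  shown to determine both parameters.\<close>

lemma frechet_derivative_at_cong:
  assumes "open S" "x \<in> S" "\<And>y. y \<in> S \<Longrightarrow> f y = g y"
  shows "frechet_derivative f (at x) = frechet_derivative g (at x)"
proof -
  have "(f has_derivative D) (at x) \<longleftrightarrow> (g has_derivative D) (at x)" for D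
    using assms has_derivative_transform_within_open[of f D x UNIV S g]
      has_derivative_transform_within_open[of g D x UNIV S f] by auto
  then show ?thesis
    by (simp add: frechet_derivative_def)
qed

lemma has_derivative_frechet:
  "f differentiable (at x) \<Longrightarrow> (f has_derivative frechet_derivative f (at x)) (at x)"
  by (simp add: frechet_derivative_works[symmetric])

lemma Cn_on_cong:
  assumes "open S" "\<And>x. x \<in> S \<Longrightarrow> f x = g x" "Cn_on n S f"
  shows "Cn_on n S g"
  using assms(2,3)
proof (induction n arbitrary: f g)
  case 0
  then show ?case
    using continuous_on_cong[of S S f g] by auto
next
  case (Suc n)
  have "g differentiable (at x)" if "x \<in> S" for x
    using has_derivative_transform_within_open[OF has_derivative_frechet \<open>open S\<close> that, of f g]
      Suc.prems that differentiableI by auto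
  moreover have "Cn_on n S (\<lambda>x. frechet_derivative g (at x) v)" for v
    using Suc.IH[of "\<lambda>x. frechet_derivative f (at x) v"] Suc.prems
      frechet_derivative_at_cong[OF \<open>open S\<close>, of _ f g] by simp
  ultimately show ?case by simp
qed

lemma Cn_on_subset: "Cn_on n S f \<Longrightarrow> T \<subseteq> S \<Longrightarrow> Cn_on n T f"
  by (induction n arbitrary: f) (auto intro: continuous_on_subset)

text \<open>Only the lowest order has content, differentiability implying continuity; at higher
  orders the induction passes to the directional derivatives.\<close>

lemma Cn_on_Suc_D: "Cn_on (Suc n) S f \<Longrightarrow> Cn_on n S f"
proof (induction n arbitrary: f)
  case 0
  then show ?case
    by (auto intro!: continuous_at_imp_continuous_on differentiable_imp_continuous_within)
qed auto

text \<open>\<open>frechet_derivative\<close> is a Hilbert choice; uniqueness of derivatives allows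
  an explicit candidate \<open>f'\<close> in its place. The closure properties below are proved
  through this rule.\<close>

lemma Cn_on_Suc_I:
  assumes "open S" "\<And>x. x \<in> S \<Longrightarrow> (f has_derivative f' x) (at x)"
    "\<And>v. Cn_on n S (\<lambda>x. f' x v)"
  shows "Cn_on (Suc n) S f"
proof -
  have "frechet_derivative f (at x) = f' x" if "x \<in> S" for x
    using assms(2) that frechet_derivative_at by metis
  then have "Cn_on n S (\<lambda>x. frechet_derivative f (at x) v)" for v
    using assms by (intro Cn_on_cong[OF assms(1) _ assms(3)]) auto
  moreover have "f differentiable (at x)" if "x \<in> S" for x
    using assms(2) that unfolding differentiable_def by blast
  ultimately show ?thesis by simp
qed

lemma Cn_on_const [simp]: "Cn_on n S (\<lambda>x. c)"
proof (induction n arbitrary: c)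
  case (Suc n)
  have "frechet_derivative (\<lambda>x::'a. c) (at x) = (\<lambda>v. 0)" for x
    by (metis frechet_derivative_at has_derivative_const)
  with Suc show ?case by simp
qed auto

lemma Cn_on_linear:
  assumes "bounded_linear L"
  shows "Cn_on n S L"
proof (cases n)
  case 0
  then show ?thesis
    using assms by (simp add: linear_continuous_on)
next
  case (Suc m)
  have "(L has_derivative L) (at x)" for x
    using assms by (rule bounded_linear_imp_has_derivative)
  then have "frechet_derivative L (at x) = L" "L differentiable (at x)" for x
    by (auto simp: differentiable_def dest: frechet_derivative_at[symmetric])
  then show ?thesis
    using Suc by simp
qed

lemma Cn_on_bounded_linear:
  assumes "bounded_linear L" "open S" "Cn_on n S f"
  shows "Cn_on n S (\<lambda>x. L (f x))"
  using assms(3)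
proof (induction n arbitrary: f)
  case 0
  then show ?case
    using bounded_linear.continuous_on[OF assms(1), of S f] by simp
next
  case (Suc n)
  then show ?case
    by (intro Cn_on_Suc_I[OF \<open>open S\<close>, where f' = "\<lambda>x v. L (frechet_derivative f (at x) v)"])
      (auto intro!: bounded_linear.has_derivative[OF assms(1)] has_derivative_frechet)
qed

lemma Cn_on_add:
  assumes "open S" "Cn_on n S f" "Cn_on n S g"
  shows "Cn_on n S (\<lambda>x. f x + g x)"
  using assms(2,3)
proof (induction n arbitrary: f g)
  case (Suc n)
  then show ?case
    by (intro Cn_on_Suc_I[OF \<open>open S\<close>, where f' = "\<lambda>x v. frechet_derivative f (at x) v
          + frechet_derivative g (at x) v"])
      (auto intro!: has_derivative_add has_derivative_frechet)
qed (auto intro: continuous_intros)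

lemma Cn_on_sum:
  assumes "open S" "\<And>i. i \<in> I \<Longrightarrow> Cn_on n S (f i)"
  shows "Cn_on n S (\<lambda>x. \<Sum>i\<in>I. f i x)"
  using assms(2) by (induction I rule: infinite_finite_induct) (auto intro!: Cn_on_add assms(1))

lemma Cn_on_Pair:
  assumes "open S" "Cn_on n S f" "Cn_on n S g"
  shows "Cn_on n S (\<lambda>x. (f x, g x))"
  using assms(2,3)
proof (induction n arbitrary: f g)
  case (Suc n)
  then show ?case
    by (intro Cn_on_Suc_I[OF \<open>open S\<close>, where f' = "\<lambda>x v. (frechet_derivative f (at x) v,
          frechet_derivative g (at x) v)"])
      (auto intro!: has_derivative_Pair has_derivative_frechet)
qed (auto intro: continuous_intros)

text \<open>The product rule mixes a derivative of one factor with the other factor itself, so the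
  induction also needs \<open>f\<close> and \<open>g\<close> at the lower order.\<close>

lemma Cn_on_bilinear:
  assumes "bounded_bilinear B" "open S" "Cn_on n S f" "Cn_on n S g"
  shows "Cn_on n S (\<lambda>x. B (f x) (g x))"
  using assms(3,4)
proof (induction n arbitrary: f g)
  case 0
  then show ?case
    using bounded_bilinear.continuous_on[OF assms(1), of S f g] by simp
next
  case (Suc n)
  have fg: "Cn_on n S f" "Cn_on n S g"
    using Suc.prems Cn_on_Suc_D by blast+
  have D: "Cn_on n S (\<lambda>x. frechet_derivative f (at x) v)" "Cn_on n S (\<lambda>x. frechet_derivative g (at x) v)"
    "x \<in> S \<Longrightarrow> (f has_derivative frechet_derivative f (at x)) (at x)"
    "x \<in> S \<Longrightarrow> (g has_derivative frechet_derivative g (at x)) (at x)" for v x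
    using Suc.prems by (simp_all add: has_derivative_frechet)
  show ?case
    by (rule Cn_on_Suc_I[OF \<open>open S\<close> bounded_bilinear.FDERIV[OF assms(1) D(3,4)]], assumption+)
      (rule Cn_on_add[OF \<open>open S\<close> Suc.IH[OF fg(1) D(2)] Suc.IH[OF D(1) fg(2)]])
qed

text \<open>In the chain rule the direction in which \<open>f\<close> is differentiated varies with
  the point, while \<open>Cn_on\<close> controls fixed directions only. Expanding in a basis
  separates the two.\<close>

lemma frechet_derivative_Basis:
  fixes f :: "'a::euclidean_space \<Rightarrow> 'b::real_normed_vector"
  assumes "f differentiable (at x)"
  shows "frechet_derivative f (at x) v = (\<Sum>i\<in>Basis. (v \<bullet> i) *\<^sub>R frechet_derivative f (at x) i)"
proof -
  have "linear (frechet_derivative f (at x))"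
    using assms linear_frechet_derivative by blast
  then have "frechet_derivative f (at x) (\<Sum>i\<in>Basis. (v \<bullet> i) *\<^sub>R i)
      = (\<Sum>i\<in>Basis. (v \<bullet> i) *\<^sub>R frechet_derivative f (at x) i)"
    by (simp add: linear_sum linear_scale)
  then show ?thesis
    by (simp add: euclidean_representation)
qed

lemma Cn_on_compose:
  fixes f :: "'a::euclidean_space \<Rightarrow> 'b::real_normed_vector"
  assumes "open S" "g ` S \<subseteq> T" "Cn_on n T f" "Cn_on n S g"
  shows "Cn_on n S (\<lambda>x. f (g x))"
  using assms(3,4)
proof (induction n arbitrary: f)
  case 0
  then show ?case
    using continuous_on_compose2[of T f S g] assms(2) by simp
next
  case (Suc n)
  have gT: "g x \<in> T" if "x \<in> S" for x
    using assms(2) that by blast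
  have D: "((\<lambda>x. f (g x)) has_derivative (\<lambda>v. \<Sum>i\<in>Basis.
      (frechet_derivative g (at x) v \<bullet> i) *\<^sub>R frechet_derivative f (at (g x)) i)) (at x)"
    if "x \<in> S" for x
  proof -
    have dif: "g differentiable (at x)" "f differentiable (at (g x))"
      using Suc.prems that gT by auto
    show ?thesis
      unfolding frechet_derivative_Basis[OF dif(2), symmetric]
      using has_derivative_compose[OF dif[THEN has_derivative_frechet]] .
  qed
  have f: "Cn_on n T (\<lambda>x. frechet_derivative f (at x) i)" for i
    using Suc.prems(1) by simp
  have g: "Cn_on n S (\<lambda>x. frechet_derivative g (at x) v)" for v
    using Suc.prems(2) by simp
  have "Cn_on n S (\<lambda>x. \<Sum>i\<in>Basis.
      (frechet_derivative g (at x) v \<bullet> i) *\<^sub>R frechet_derivative f (at (g x)) i)" for v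
    by (rule Cn_on_sum[OF assms(1)], rule Cn_on_bilinear[OF bounded_bilinear_scaleR assms(1)
      Cn_on_bounded_linear[OF bounded_linear_inner_left assms(1) g] Suc.IH[OF f Cn_on_Suc_D[OF Suc.prems(2)]]])
  with D show ?case
    by (rule Cn_on_Suc_I[OF \<open>open S\<close>])
qed

lemma Cn_on_inverse: "Cn_on n (- {0}) (inverse :: real \<Rightarrow> real)"
proof (induction n)
  case (Suc n)
  show ?case
    by (rule Cn_on_Suc_I[where f' = "\<lambda>x v. - (inverse x * v * inverse x)"])
      (auto intro!: Cn_on_bounded_linear[OF bounded_linear_minus[OF bounded_linear_ident]] Suc
       Cn_on_bilinear[OF bounded_bilinear_mult] has_derivative_inverse')
qed (auto intro!: continuous_intros)

section \<open>Closure properties of smooth maps, from those at every finite order\<close>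

lemma smooth_on_imp_Cn_on: "smooth_on S f \<Longrightarrow> Cn_on n S f"
  by (simp add: smooth_on_def)

lemma smooth_on_subset: "smooth_on S f \<Longrightarrow> T \<subseteq> S \<Longrightarrow> smooth_on T f"
  by (auto simp: smooth_on_def intro: Cn_on_subset[of _ S f T])

lemma smooth_on_cong:
  "open S \<Longrightarrow> (\<And>x. x \<in> S \<Longrightarrow> f x = g x) \<Longrightarrow> smooth_on S f \<Longrightarrow> smooth_on S g"
  by (auto simp: smooth_on_def intro: Cn_on_cong[of S f g])

lemma smooth_on_continuous_on: "smooth_on S f \<Longrightarrow> continuous_on S f"
  using smooth_on_imp_Cn_on[of S f 0] by simp

lemma smooth_on_differentiable: "smooth_on S f \<Longrightarrow> x \<in> S \<Longrightarrow> f differentiable (at x)"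
  using smooth_on_imp_Cn_on[of S f "Suc 0"] by simp

lemma smooth_on_has_derivative:
  "smooth_on S f \<Longrightarrow> x \<in> S \<Longrightarrow> (f has_derivative frechet_derivative f (at x)) (at x)"
  by (simp add: has_derivative_frechet smooth_on_differentiable)

lemma smooth_on_frechet_derivative:
  "smooth_on S f \<Longrightarrow> smooth_on S (\<lambda>x. frechet_derivative f (at x) v)"
  unfolding smooth_on_def using Cn_on.simps(2)[of _ S f] by blast

lemma smooth_on_const: "smooth_on S (\<lambda>x. c)"
  by (simp add: smooth_on_def)

lemma smooth_on_linear: "bounded_linear L \<Longrightarrow> smooth_on S L"
  by (simp add: smooth_on_def Cn_on_linear)

lemma smooth_on_bounded_linear:
  "bounded_linear L \<Longrightarrow> open S \<Longrightarrow> smooth_on S f \<Longrightarrow> smooth_on S (\<lambda>x. L (f x))"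
  by (simp add: smooth_on_def Cn_on_bounded_linear)

lemma smooth_on_add:
  "open S \<Longrightarrow> smooth_on S f \<Longrightarrow> smooth_on S g \<Longrightarrow> smooth_on S (\<lambda>x. f x + g x)"
  by (simp add: smooth_on_def Cn_on_add)

lemma smooth_on_diff:
  "open S \<Longrightarrow> smooth_on S f \<Longrightarrow> smooth_on S g \<Longrightarrow> smooth_on S (\<lambda>x. f x - g x)"
  using smooth_on_add[of S f "\<lambda>x. - g x"]
    smooth_on_bounded_linear[OF bounded_linear_minus[OF bounded_linear_ident], of S g] by simp

lemma smooth_on_mult:
  fixes f g :: "'a::real_normed_vector \<Rightarrow> real"
  shows "open S \<Longrightarrow> smooth_on S f \<Longrightarrow> smooth_on S g \<Longrightarrow> smooth_on S (\<lambda>x. f x * g x)"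
  by (simp add: smooth_on_def Cn_on_bilinear[OF bounded_bilinear_mult])

lemma smooth_on_Pair:
  "open S \<Longrightarrow> smooth_on S f \<Longrightarrow> smooth_on S g \<Longrightarrow> smooth_on S (\<lambda>x. (f x, g x))"
  by (simp add: smooth_on_def Cn_on_Pair)

lemma smooth_on_compose:
  fixes f :: "'a::euclidean_space \<Rightarrow> 'b::real_normed_vector"
  shows "open S \<Longrightarrow> smooth_on T f \<Longrightarrow> smooth_on S g \<Longrightarrow> g ` S \<subseteq> T \<Longrightarrow> smooth_on S (\<lambda>x. f (g x))"
  by (auto simp: smooth_on_def intro: Cn_on_compose[of S g T _ f])

lemma smooth_on_divide:
  fixes f g :: "'a::real_normed_vector \<Rightarrow> real"
  assumes "open S" "smooth_on S f" "smooth_on S g" "\<And>x. x \<in> S \<Longrightarrow> g x \<noteq> 0"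
  shows "smooth_on S (\<lambda>x. f x / g x)"
proof -
  have "smooth_on (- {0}) (inverse :: real \<Rightarrow> real)"
    by (simp add: smooth_on_def Cn_on_inverse)
  then have "smooth_on S (\<lambda>x. inverse (g x))"
    using assms by (intro smooth_on_compose[where T = "- {0}" and f = inverse and g = g]) auto
  then show ?thesis
    using smooth_on_mult[OF assms(1,2)] by (simp add: divide_inverse)
qed

section \<open>Smoothness of real functions from equations for their derivative\<close>

lemma smooth_on_antiderivative:
  fixes f :: "real \<Rightarrow> real"
  assumes "open S" "\<And>x. x \<in> S \<Longrightarrow> (f has_real_derivative f' x) (at x)" "smooth_on S f'"
  shows "smooth_on S f"
proof -
  have "Cn_on (Suc n) S f" for n
    using assms by (intro Cn_on_Suc_I[where f' = "\<lambda>x v. f' x * v"])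
      (auto simp: has_field_derivative_def smooth_on_def intro!: Cn_on_bilinear[OF bounded_bilinear_mult])
  then show ?thesis
    unfolding smooth_on_def using Cn_on_Suc_D by blast
qed

text \<open>Regularity is bootstrapped from \<open>h' = 1 / (d \<circ> h)\<close>.\<close>

lemma smooth_on_inverse_function:
  fixes h :: "real \<Rightarrow> real"
  assumes "open S" "\<And>x. x \<in> S \<Longrightarrow> (h has_real_derivative 1 / d (h x)) (at x)"
    "h ` S \<subseteq> T" "smooth_on T d" "\<And>x. x \<in> T \<Longrightarrow> d x \<noteq> 0" "open T"
  shows "smooth_on S h"
proof -
  have d: "smooth_on T (\<lambda>x. 1 / d x)"
    using assms by (intro smooth_on_divide smooth_on_const) auto
  have "Cn_on n S h" for n
  proof (induction n)
    case 0
    show ?case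
      using assms(2) by (auto intro!: continuous_at_imp_continuous_on DERIV_isCont)
  next
    case (Suc n)
    have "Cn_on n S (\<lambda>x. 1 / d (h x))"
      using Cn_on_compose[OF assms(1,3) smooth_on_imp_Cn_on[OF d] Suc] .
    then show ?case
      using assms by (intro Cn_on_Suc_I[where f' = "\<lambda>x v. 1 / d (h x) * v"])
        (auto simp: has_field_derivative_def simp del: times_divide_eq_left
          intro!: Cn_on_bilinear[OF bounded_bilinear_mult])
  qed
  then show ?thesis
    by (simp add: smooth_on_def)
qed

section \<open>Immersions and tangent planes\<close>

text \<open>A continuous lift \<open>F\<close> of \<open>f\<close> through an immersion \<open>\<phi>\<close> is differentiable: with a left inverse
  \<open>K\<close> of the derivative of \<open>\<phi>\<close>, the remainder \<open>K \<circ> \<phi> - id\<close> is of first order negligible, so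
  \<open>F\<close> differs from \<open>K \<circ> f\<close> by a term that is small compared with \<open>F\<close> itself.\<close>

lemma has_derivative_lift_immersion:
  fixes \<phi> :: "'b::real_normed_vector \<Rightarrow> 'c::real_normed_vector"
    and f :: "'a::real_normed_vector \<Rightarrow> 'c"
  assumes f: "(f has_derivative M) (at u within S)" and u: "u \<in> S"
    and F: "continuous (at u within S) F"
    and \<phi>: "(\<phi> has_derivative L) (at (F u))"
    and K: "bounded_linear K" "\<And>w. K (L w) = w"
    and lift: "\<And>v. v \<in> S \<Longrightarrow> \<phi> (F v) = f v"
  shows "(F has_derivative (\<lambda>h. K (M h))) (at u within S)"
proof -
  have Kf: "((\<lambda>v. K (f v)) has_derivative (\<lambda>h. K (M h))) (at u within S)"
    using f by (rule bounded_linear.has_derivative[OF K(1)])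
  then have lin: "bounded_linear (\<lambda>h. K (M h))"
    by (rule has_derivative_bounded_linear)
  then obtain C where C: "C > 0" "\<And>h. norm (K (M h)) \<le> norm h * C"
    using bounded_linear.pos_bounded by blast
  have K\<phi>: "((\<lambda>w. K (\<phi> w)) has_derivative (\<lambda>h. h)) (at (F u))"
    using bounded_linear.has_derivative[OF K(1) \<phi>] K(2) by simp
  show ?thesis
    unfolding has_derivative_within_alt2
  proof (intro conjI lin allI impI)
    fix e :: real assume "e > 0"
    \<comment> \<open>The bound 1/2 allows \<open>d * norm x\<close> to be absorbed into
      \<open>norm x\<close>, giving \<open>norm x \<le> 2 * norm k\<close>. The total error is then
      \<open>d * (2 * (C + 1)) + d = d * (2 * C + 3)\<close> times
      \<open>norm (v - u)\<close>.\<close>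
    define d where "d = min (1/2) (e / (2 * C + 3))"
    have d: "d > 0" "d \<le> 1/2" "d \<le> e / (2 * C + 3)"
      using \<open>e > 0\<close> C(1) min.cobounded1 min.cobounded2 by (simp_all only: d_def) auto
    then have d3: "d * (2 * C + 3) \<le> e"
      using C(1) by (simp add: pos_le_divide_eq)
    have "\<forall>\<^sub>F w in at (F u). norm (K (\<phi> w) - K (\<phi> (F u)) - (w - F u)) \<le> d * norm (w - F u)"
      using K\<phi> d(1) unfolding has_derivative_within_alt2 by blast
    \<comment> \<open>The point \<open>F u\<close> has to be included, since
      \<open>F v = F u\<close> may happen for \<open>v\<close> different from \<open>u\<close>;
      there both sides vanish.\<close>
    then have "\<forall>\<^sub>F w in nhds (F u). norm (K (\<phi> w) - K (\<phi> (F u)) - (w - F u)) \<le> d * norm (w - F u)"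
      unfolding eventually_at_filter by (rule eventually_mono) auto
    then have 1: "\<forall>\<^sub>F v in at u within S.
        norm (K (\<phi> (F v)) - K (\<phi> (F u)) - (F v - F u)) \<le> d * norm (F v - F u)"
      using F unfolding continuous_within filterlim_iff by blast
    have 2: "\<forall>\<^sub>F v in at u within S.
        norm (K (f v) - K (f u) - K (M (v - u))) \<le> d * norm (v - u)"
      using Kf d(1) unfolding has_derivative_within_alt2 by blast
    have 3: "\<forall>\<^sub>F v in at u within S. v \<in> S"
      unfolding eventually_at_filter by simp
    from 1 2 3 show "\<forall>\<^sub>F v in at u within S. norm (F v - F u - K (M (v - u))) \<le> e * norm (v - u)"
    proof eventually_elim
      case (elim v)
      define x where "x = F v - F u"
      define k where "k = K (f v) - K (f u)"
      define m where "m = K (M (v - u))"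
      have a: "norm (k - x) \<le> d * norm x" "norm (k - m) \<le> d * norm (v - u)"
        using elim lift[OF elim(3)] lift[OF u] by (simp_all add: x_def k_def m_def)
      have "norm m \<le> norm (v - u) * C"
        using C(2) by (simp add: m_def)
      moreover have "norm k \<le> norm (k - m) + norm m"
        by (metis diff_add_cancel norm_triangle_ineq)
      moreover have "d * norm (v - u) \<le> norm (v - u)"
        using d by (simp add: mult_left_le_one_le)
      ultimately have k: "norm k \<le> norm (v - u) * (C + 1)"
        using a(2) by (simp add: algebra_simps)
      have "norm x \<le> norm (k - x) + norm k"
        by (metis add.commute norm_minus_commute diff_add_cancel norm_triangle_ineq)
      moreover have "d * norm x \<le> norm x / 2"
        using mult_right_mono[OF d(2) norm_ge_zero[of x]] by simp
      ultimately have "norm x \<le> 2 * (norm (v - u) * (C + 1))"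
        using a(1) k by linarith
      then have "d * norm x \<le> d * (2 * (norm (v - u) * (C + 1)))"
        using d(1) by (simp add: mult_left_mono)
      moreover have "norm (x - m) \<le> norm (k - x) + norm (k - m)"
        using norm_triangle_ineq4[of "k - m" "k - x"] by (simp add: add.commute)
      ultimately have "norm (x - m) \<le> d * (2 * (norm (v - u) * (C + 1))) + d * norm (v - u)"
        using a by linarith
      also have "\<dots> = d * (2 * C + 3) * norm (v - u)"
        by (simp add: algebra_simps)
      also have "\<dots> \<le> e * norm (v - u)"
        using d3 by (simp add: mult_right_mono)
      finally show ?case
        by (simp add: x_def m_def)
    qed
  qed
qed

section \<open>Tangent planes of a surface in terms of a patch\<close>

lemma surface_patch_left_inverse:
  assumes "surface_patch \<Sigma> U \<phi>" "u \<in> U"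
  obtains K where "bounded_linear K" "\<And>w. K (frechet_derivative \<phi> (at u) w) = w"
proof -
  have \<phi>: "linear (frechet_derivative \<phi> (at u))" "inj (frechet_derivative \<phi> (at u))"
    using assms smooth_on_differentiable linear_frechet_derivative unfolding surface_patch_def by blast+
  then obtain K where "linear K" "K \<circ> frechet_derivative \<phi> (at u) = id"
    using linear_injective_left_inverse by blast
  then show ?thesis
    using that[of K] by (metis comp_apply id_apply linear_conv_bounded_linear)
qed

lemma surface_patch_has_derivative:
  "surface_patch \<Sigma> U \<phi> \<Longrightarrow> u \<in> U \<Longrightarrow> (\<phi> has_derivative frechet_derivative \<phi> (at u)) (at u)"
  unfolding surface_patch_def using smooth_on_has_derivative by blast

lemma surface_patch_subset: "surface_patch \<Sigma> U \<phi> \<Longrightarrow> \<phi> ` U \<subseteq> \<Sigma>"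
  unfolding surface_patch_def by (blast dest: openin_imp_subset)

text \<open>The image under \<open>\<phi>\<close> of a short straight segment through
  \<open>u\<close> in direction \<open>w\<close> is a smooth curve in the surface with the required
  velocity.\<close>

lemma smooth_curve_tangent:
  assumes "surface_patch \<Sigma> U \<phi>" "u \<in> U"
  shows "frechet_derivative \<phi> (at u) w \<in> tangent_plane \<Sigma> (\<phi> u)"
proof -
  define l where "l = (\<lambda>t::real. u + t *\<^sub>R w)"
  have sm: "smooth_on U \<phi>" and "open U"
    using assms by (auto simp: surface_patch_def)
  have "isCont l 0" "l 0 \<in> U"
    unfolding l_def using assms(2) by (auto intro!: continuous_intros)
  then have "\<forall>\<^sub>F t in nhds 0. l t \<in> U"
    using \<open>open U\<close> topological_tendstoD unfolding isCont_def tendsto_at_iff_tendsto_nhds by blast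
  then obtain \<epsilon> where \<epsilon>: "\<epsilon> > 0" "\<And>t. \<bar>t\<bar> < \<epsilon> \<Longrightarrow> l t \<in> U"
    unfolding eventually_nhds_metric by (auto simp: dist_real_def)
  have sml: "smooth_on {-\<epsilon><..<\<epsilon>} l"
    unfolding l_def
    by (intro smooth_on_add smooth_on_const smooth_on_linear bounded_linear_scaleR_left) auto
  have lU: "l ` {-\<epsilon><..<\<epsilon>} \<subseteq> U"
    using \<epsilon>(2) by auto
  have "smooth_on {-\<epsilon><..<\<epsilon>} (\<lambda>t. \<phi> (l t))"
    by (rule smooth_on_compose[OF _ sm sml lU]) simp
  moreover have "(\<lambda>t. \<phi> (l t)) ` {-\<epsilon><..<\<epsilon>} \<subseteq> \<Sigma>"
    using lU surface_patch_subset[OF assms(1)] by auto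
  moreover have "((\<lambda>t. \<phi> (l t)) has_vector_derivative frechet_derivative \<phi> (at u) w) (at 0)"
  proof -
    have l: "(l has_derivative (\<lambda>t. t *\<^sub>R w)) (at 0)"
      unfolding l_def by (auto intro!: derivative_eq_intros)
    have "(\<phi> has_derivative frechet_derivative \<phi> (at u)) (at (l 0))"
      using surface_patch_has_derivative[OF assms] by (simp add: l_def)
    from has_derivative_compose[OF l this] show ?thesis
      using linear_frechet_derivative[OF smooth_on_differentiable[OF sm assms(2)]]
      by (simp add: has_vector_derivative_def linear_scale)
  qed
  ultimately show ?thesis
    unfolding tangent_plane_def using \<epsilon>(1)
    by (auto simp: l_def intro!: exI[of _ \<epsilon>] exI[of _ "\<lambda>t. \<phi> (l t)"])
qed

text \<open>Since the patch is relatively open, a curve in the surface through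
  \<open>\<phi> u\<close> stays in it for small times and has the continuous lift
  \<open>\<psi> \<circ> \<gamma>\<close>. The lift is differentiable because \<open>\<phi>\<close>
  is an immersion, and the chain rule puts the velocity into the range.\<close>

lemma tangent_plane_eq:
  assumes patch: "surface_patch \<Sigma> U \<phi>" and u: "u \<in> U"
  shows "tangent_plane \<Sigma> (\<phi> u) = range (frechet_derivative \<phi> (at u))"
proof (intro equalityI subsetI)
  fix v assume "v \<in> tangent_plane \<Sigma> (\<phi> u)"
  then obtain \<epsilon> \<gamma> where \<epsilon>: "\<epsilon> > 0" and \<gamma>: "smooth_on {-\<epsilon><..<\<epsilon>} \<gamma>" "\<gamma> ` {-\<epsilon><..<\<epsilon>} \<subseteq> \<Sigma>" "\<gamma> 0 = \<phi> u"
    "(\<gamma> has_vector_derivative v) (at 0)"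
    unfolding tangent_plane_def by blast
  obtain \<psi> where \<psi>: "homeomorphism U (\<phi> ` U) \<phi> \<psi>"
    using patch by (auto simp: surface_patch_def)
  obtain V where V: "open V" "\<phi> ` U = \<Sigma> \<inter> V"
    using patch by (auto simp: surface_patch_def openin_open)
  define S where "S = {-\<epsilon><..<\<epsilon>} \<inter> \<gamma> -` V"
  have cont: "continuous_on {-\<epsilon><..<\<epsilon>} \<gamma>"
    using \<gamma>(1) by (rule smooth_on_continuous_on)
  have S: "open S"
    unfolding S_def using cont V(1) by (intro continuous_open_preimage) auto
  have 0: "0 \<in> S"
    using \<epsilon> \<gamma>(3) V u by (auto simp: S_def)
  have im: "\<gamma> t \<in> \<phi> ` U" if "t \<in> S" for t
    using that \<gamma>(2) V by (auto simp: S_def)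
  have "continuous_on S (\<lambda>t. \<psi> (\<gamma> t))"
    using im by (intro continuous_on_compose2[OF homeomorphism_cont2[OF \<psi>] continuous_on_subset[OF cont]])
      (auto simp only: S_def image_subset_iff)
  then have c: "continuous (at 0 within S) (\<lambda>t. \<psi> (\<gamma> t))"
    using 0 by (simp add: continuous_on_eq_continuous_within)
  have \<psi>0: "\<psi> (\<gamma> 0) = u"
    using \<psi> u by (simp add: \<gamma>(3) homeomorphism_apply1)
  obtain K where K: "bounded_linear K" "\<And>w. K (frechet_derivative \<phi> (at u) w) = w"
    using surface_patch_left_inverse[OF patch u] by blast
  have g: "(\<gamma> has_derivative (\<lambda>t. t *\<^sub>R v)) (at 0 within S)"
    using \<gamma>(4) by (simp add: has_vector_derivative_def has_derivative_at_withinI)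
  have "((\<lambda>t. \<psi> (\<gamma> t)) has_derivative (\<lambda>t. K (t *\<^sub>R v))) (at 0 within S)"
    by (rule has_derivative_lift_immersion[OF g 0 c _ K])
      (use surface_patch_has_derivative[OF patch u] \<psi> im \<psi>0 in \<open>auto intro: homeomorphism_apply2\<close>)
  moreover have "(\<phi> has_derivative frechet_derivative \<phi> (at u)) (at (\<psi> (\<gamma> 0)))"
    using surface_patch_has_derivative[OF patch u] by (simp add: \<psi>0)
  ultimately have "((\<lambda>t. \<phi> (\<psi> (\<gamma> t))) has_derivative
      (\<lambda>t. frechet_derivative \<phi> (at u) (K (t *\<^sub>R v)))) (at 0 within S)"
    by (rule has_derivative_compose)
  then have "(\<gamma> has_derivative (\<lambda>t. frechet_derivative \<phi> (at u) (K (t *\<^sub>R v)))) (at 0 within S)"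
    by (rule has_derivative_transform_within[OF _ zero_less_one 0])
      (use \<psi> im in \<open>auto intro: homeomorphism_apply2\<close>)
  with g have "(\<lambda>t. t *\<^sub>R v) = (\<lambda>t. frechet_derivative \<phi> (at u) (K (t *\<^sub>R v)))"
    unfolding at_within_open[OF 0 S] by (rule has_derivative_unique)
  from fun_cong[OF this, of 1] have "v = frechet_derivative \<phi> (at u) (K v)"
    by simp
  then show "v \<in> range (frechet_derivative \<phi> (at u))"
    by blast
qed (use smooth_curve_tangent[OF assms] in auto)

text \<open>Linearity is not visible from the definition by curves; it is inherited from the
  derivative of the patch, whose injectivity gives the dimension.\<close>

lemma subspace_tangent_plane:
  assumes "surface_patch \<Sigma> U \<phi>" "p \<in> \<phi> ` U"
  shows "subspace (tangent_plane \<Sigma> p)" "dim (tangent_plane \<Sigma> p) = 2"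
proof -
  obtain u where u: "u \<in> U" "p = \<phi> u"
    using assms by blast
  have \<phi>: "linear (frechet_derivative \<phi> (at u))" "inj (frechet_derivative \<phi> (at u))"
    using assms u smooth_on_differentiable linear_frechet_derivative unfolding surface_patch_def by blast+
  show "subspace (tangent_plane \<Sigma> p)"
    unfolding u(2) tangent_plane_eq[OF assms(1) u(1)] by (rule linear_subspace_image[OF \<phi>(1) subspace_UNIV])
  show "dim (tangent_plane \<Sigma> p) = 2"
    unfolding u(2) tangent_plane_eq[OF assms(1) u(1)] using dim_image_eq[OF \<phi>(1), of UNIV] \<phi>(2) by simp
qed


section \<open>Regular points\<close>

text \<open>With horizontal components \<open>(c, s)\<close> of \<open>e\<close>, those of
  \<open>J p e\<close> are \<open>(- s, c)\<close>, an orthonormal pair. The third Euclidean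
  coordinate of a contact vector is determined by the first two, so it is enough to expand
  these.\<close>

lemma contact_plane_basis:
  assumes "e \<in> contact_plane p" "adapted_metric p e e = 1" "v \<in> contact_plane p"
  shows "v = adapted_metric p v e *\<^sub>R e + adapted_metric p v (J p e) *\<^sub>R J p e"
proof -
  obtain x y z where p: "p = (x, y, z)" by (rule prod_cases3)
  obtain c s k where e: "e = (c, s, k)" by (rule prod_cases3)
  obtain c' s' k' where v: "v = (c', s', k')" by (rule prod_cases3)
  have k: "k = y * c - x * s" "k' = y * c' - x * s'" and cs: "c\<^sup>2 + s\<^sup>2 = 1"
    using assms by (auto simp: contact_plane_def adapted_metric_def p e v power2_eq_square)
  have "adapted_metric p v e = c' * c + s' * s" "adapted_metric p v (J p e) = s' * c - c' * s"
    using k by (simp_all add: adapted_metric_def p e v algebra_simps)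
  moreover have "c' = (c' * c + s' * s) * c + (s' * c - c' * s) * - s"
    "s' = (c' * c + s' * s) * s + (s' * c - c' * s) * c"
    "k' = (c' * c + s' * s) * k + (s' * c - c' * s) * - (c * x + s * y)"
    using k cs by algebra+
  ultimately show ?thesis
    by (simp add: p e v)
qed

text \<open>If \<open>J p e\<close> were tangent, then \<open>e\<close> and \<open>J p e\<close>
  would span the contact plane inside the tangent plane. Equal dimensions would make the two planes
  coincide, and \<open>p\<close> would be singular.\<close>

lemma J_not_tangent:
  assumes T: "subspace (tangent_plane \<Sigma> p)" "dim (tangent_plane \<Sigma> p) = 2"
    and p: "p \<in> \<Sigma>" "\<not> singular_point \<Sigma> p"
    and e: "e \<in> tangent_plane \<Sigma> p \<inter> contact_plane p" "adapted_metric p e e = 1"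
  shows "J p e \<notin> tangent_plane \<Sigma> p"
proof
  assume Je: "J p e \<in> tangent_plane \<Sigma> p"
  define L where "L = (\<lambda>v::real \<times> real. fst v *\<^sub>R E1 p + snd v *\<^sub>R E2 p)"
  have L: "linear L" "inj L"
    unfolding L_def by (cases p; auto intro!: linearI injI simp: algebra_simps)+
  have eq: "contact_plane p = range L"
  proof (intro equalityI subsetI)
    fix v assume "v \<in> contact_plane p"
    then have "v = L (fst v, fst (snd v))"
      by (cases p; cases v) (auto simp: contact_plane_def L_def algebra_simps)
    then show "v \<in> range L" by blast
  qed (cases p; auto simp: contact_plane_def L_def algebra_simps)
  have "contact_plane p \<subseteq> tangent_plane \<Sigma> p"
  proof
    fix v assume "v \<in> contact_plane p"
    then show "v \<in> tangent_plane \<Sigma> p"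
      using contact_plane_basis[of e p v] e Je T(1) subspace_add subspace_scale by (metis IntE)
  qed
  moreover have "dim (contact_plane p) = 2" "subspace (contact_plane p)"
    using L dim_image_eq[of L UNIV] linear_subspace_image[of L UNIV] unfolding eq by simp_all
  ultimately have "contact_plane p = tangent_plane \<Sigma> p"
    using T by (intro subspace_dim_equal) auto
  with p show False
    by (simp add: singular_point_def)
qed

text \<open>A nonzero component of \<open>v\<close> along \<open>J p e\<close> could be solved for
  \<open>J p e\<close>, making it tangent.\<close>

lemma characteristic_direction_unique:
  assumes "subspace (tangent_plane \<Sigma> p)" "dim (tangent_plane \<Sigma> p) = 2"
    "p \<in> \<Sigma>" "\<not> singular_point \<Sigma> p"
    and e: "e \<in> tangent_plane \<Sigma> p \<inter> contact_plane p" "adapted_metric p e e = 1"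
    and v: "v \<in> tangent_plane \<Sigma> p \<inter> contact_plane p" "adapted_metric p v v = 1"
  shows "v = adapted_metric p v e *\<^sub>R e" "\<bar>adapted_metric p v e\<bar> = 1"
proof -
  have eq: "v = adapted_metric p v e *\<^sub>R e + adapted_metric p v (J p e) *\<^sub>R J p e"
    using e v by (intro contact_plane_basis) auto
  have "adapted_metric p v (J p e) = 0"
  proof (rule ccontr)
    assume ne: "adapted_metric p v (J p e) \<noteq> 0"
    have "v - adapted_metric p v e *\<^sub>R e \<in> tangent_plane \<Sigma> p"
      using e v assms(1) by (intro subspace_diff subspace_scale) auto
    moreover have "v - adapted_metric p v e *\<^sub>R e = adapted_metric p v (J p e) *\<^sub>R J p e"
      using eq by (simp add: diff_eq_eq add.commute)
    then have "J p e = (1 / adapted_metric p v (J p e)) *\<^sub>R (v - adapted_metric p v e *\<^sub>R e)"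
      using ne by simp
    ultimately have "J p e \<in> tangent_plane \<Sigma> p"
      using assms(1) subspace_scale by metis
    then show False
      using J_not_tangent assms by blast
  qed
  with eq show *: "v = adapted_metric p v e *\<^sub>R e"
    by simp
  have "adapted_metric p (r *\<^sub>R e) (r *\<^sub>R e) = r\<^sup>2 * adapted_metric p e e" for r
    by (cases p; cases e) (simp add: adapted_metric_def power2_eq_square algebra_simps)
  then have "(adapted_metric p v e)\<^sup>2 = 1"
    using * e v by (metis mult.right_neutral)
  then show "\<bar>adapted_metric p v e\<bar> = 1"
    by (auto simp: power2_eq_1_iff)
qed

text \<open>Two candidates for the definite description differ by a multiple of
  \<open>J p (e p)\<close>, which is tangent only if the multiple is zero.\<close>

lemma alpha_eqI:
  assumes "subspace (tangent_plane \<Sigma> p)" "J p (e p) \<notin> tangent_plane \<Sigma> p"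
    "r *\<^sub>R J p (e p) + Reeb \<in> tangent_plane \<Sigma> p"
  shows "alpha \<Sigma> e p = r"
  unfolding alpha_def
proof (rule the_equality)
  fix r' assume r': "r' *\<^sub>R J p (e p) + Reeb \<in> tangent_plane \<Sigma> p"
  have "(r' *\<^sub>R J p (e p) + Reeb) - (r *\<^sub>R J p (e p) + Reeb) \<in> tangent_plane \<Sigma> p"
    using assms r' subspace_diff by blast
  then have *: "(r' - r) *\<^sub>R J p (e p) \<in> tangent_plane \<Sigma> p"
    by (simp add: algebra_simps)
  show "r' = r"
  proof (rule ccontr)
    assume "r' \<noteq> r"
    then have "J p (e p) = (1 / (r' - r)) *\<^sub>R (r' - r) *\<^sub>R J p (e p)"
      by simp
    then show False
      using * assms subspace_scale by metis
  qed
qed (rule assms)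

section \<open>The ruling of a p-minimal surface\<close>

lemma compatible_coordsD:
  assumes "compatible_coords \<Sigma> e U \<phi> a b"
  shows "surface_patch \<Sigma> U \<phi>" "characteristic_field \<Sigma> (\<phi> ` U) e"
    "open U" "smooth_on U \<phi>"
    "\<And>u. u \<in> U \<Longrightarrow> frechet_derivative \<phi> (at u) (1, 0) = e (\<phi> u)"
    "\<And>u. u \<in> U \<Longrightarrow> (\<phi> has_derivative frechet_derivative \<phi> (at u)) (at u)"
    "\<And>u. u \<in> U \<Longrightarrow> e2_hat \<Sigma> e (\<phi> u) =
       a u *\<^sub>R e (\<phi> u) + b u *\<^sub>R frechet_derivative \<phi> (at u) (0, 1)"
    "\<And>u. u \<in> U \<Longrightarrow> b u > 0"
  using assms surface_patch_has_derivative[of \<Sigma> U \<phi>]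
  unfolding compatible_coords_def surface_patch_def by auto

lemma characteristic_field_regular:
  assumes "surface_patch \<Sigma> U \<phi>" "characteristic_field \<Sigma> W e" "p \<in> \<phi> ` U" "p \<in> W"
  shows "p \<in> \<Sigma>" "\<not> singular_point \<Sigma> p" "e p \<in> tangent_plane \<Sigma> p \<inter> contact_plane p"
    "adapted_metric p (e p) (e p) = 1" "J p (e p) \<notin> tangent_plane \<Sigma> p"
proof -
  show *: "p \<in> \<Sigma>" "\<not> singular_point \<Sigma> p" "e p \<in> tangent_plane \<Sigma> p \<inter> contact_plane p"
    "adapted_metric p (e p) (e p) = 1"
    using assms surface_patch_subset[OF assms(1)] unfolding characteristic_field_def by auto
  show "J p (e p) \<notin> tangent_plane \<Sigma> p"
    using J_not_tangent[OF subspace_tangent_plane[OF assms(1,3)] *] .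
qed

section \<open>Partial derivatives and component formulas\<close>

lemma partial_x:
  assumes "(f has_derivative D) (at (x, y))"
  shows "((\<lambda>t. f (t, y)) has_vector_derivative D (1, 0)) (at x)"
proof -
  have "((\<lambda>t. (t, y)) has_derivative (\<lambda>t. (t, 0))) (at x)"
    by (auto intro!: derivative_eq_intros)
  from has_derivative_compose[OF this assms]
  have "((\<lambda>t. f (t, y)) has_derivative (\<lambda>t. D (t, 0))) (at x)" .
  moreover have "(\<lambda>t. D (t, 0)) = (\<lambda>t. t *\<^sub>R D (1, 0))"
    using linear_scale[OF has_derivative_linear[OF assms], of _ "(1, 0)"]
    unfolding scaleR_Pair real_scaleR_def mult_1_right mult_zero_right scaleR_zero_right by (intro ext)
  ultimately show ?thesis
    unfolding has_vector_derivative_def by (simp only:)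
qed

lemma partial_y:
  assumes "(f has_derivative D) (at (x, y))"
  shows "((\<lambda>t. f (x, t)) has_vector_derivative D (0, 1)) (at y)"
proof -
  have "((\<lambda>t. (x, t)) has_derivative (\<lambda>t. (0, t))) (at y)"
    by (auto intro!: derivative_eq_intros)
  from has_derivative_compose[OF this assms]
  have "((\<lambda>t. f (x, t)) has_derivative (\<lambda>t. D (0, t))) (at y)" .
  moreover have "(\<lambda>t. D (0, t)) = (\<lambda>t. t *\<^sub>R D (0, 1))"
    using linear_scale[OF has_derivative_linear[OF assms], of _ "(0, 1)"]
    unfolding scaleR_Pair real_scaleR_def mult_1_right mult_zero_right scaleR_zero_right by (intro ext)
  ultimately show ?thesis
    unfolding has_vector_derivative_def by (simp only:)
qed

lemma vector_derivative_zero_const: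
  fixes f :: "real \<Rightarrow> 'a::real_normed_vector"
  assumes "open S" "connected S" "\<And>t. t \<in> S \<Longrightarrow> (f has_vector_derivative 0) (at t)" "x \<in> S" "y \<in> S"
  shows "f x = f y"
  using assms by (intro has_derivative_zero_unique_connected[of S f])
    (auto simp: has_vector_derivative_def)

text \<open>A contact vector has no \<open>Reeb\<close> component, and the first two frame
  components of any vector are its Euclidean coordinates. Metric computations against
  \<open>e\<close> and \<open>J p e\<close> thus become algebra in the plane.\<close>

lemma adapted_metric_contact:
  "e \<in> contact_plane p \<Longrightarrow> adapted_metric p v e = fst v * fst e + fst (snd v) * fst (snd e)"
  by (cases p; cases e; cases v) (auto simp: contact_plane_def adapted_metric_def)

lemma contact_planeD: "e \<in> contact_plane p \<Longrightarrow> snd (snd e) = fst (snd p) * fst e - fst p * fst (snd e)"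
  by (cases p; cases e) (auto simp: contact_plane_def)

lemma J_contact_plane: "J p e \<in> contact_plane p"
  by (cases p; cases e) (auto simp: contact_plane_def algebra_simps)

lemma J_components: "fst (J p e) = - fst (snd e)" "fst (snd (J p e)) = fst e"
  by (cases p; cases e; simp)+

lemma contact_form_expand: "contact_form p v = snd (snd v) + fst p * fst (snd v) - fst (snd p) * fst v"
  by (cases p; cases v) simp

text \<open>The formula for \<open>e2_hat\<close> in the chart says that
  \<open>\<alpha> J e + T = w (a e + b v)\<close> with
  \<open>w = sqrt (1 + \<alpha>\<^sup>2)\<close>. Pairing it with \<open>e\<close>, with
  \<open>J e\<close> and with the contact form gives \<open>0 = w (a + b <v, e>)\<close>,
  \<open>\<alpha> = w b <v, J e>\<close> and \<open>1 = w b \<Theta>(v)\<close>; the second and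
  third yield the relation without \<open>b\<close>. The right side is visibly tangent, so existence
  of the \<alpha>-value comes with the chart.\<close>

lemma compatible_coords_relations:
  assumes "compatible_coords \<Sigma> e U \<phi> a b" and u: "u \<in> U"
  defines "p \<equiv> \<phi> u" and "v \<equiv> frechet_derivative \<phi> (at u) (0, 1)"
    and "\<alpha> \<equiv> alpha \<Sigma> e (\<phi> u)"
  shows "a u + b u * adapted_metric p v (e p) = 0"
    "adapted_metric p v (J p (e p)) = \<alpha> * contact_form p v"
    "b u * contact_form p v * sqrt (1 + \<alpha>\<^sup>2) = 1"
    "\<alpha> *\<^sub>R J p (e p) + Reeb \<in> tangent_plane \<Sigma> p"
proof -
  note C = compatible_coordsD[OF assms(1)]
  have reg: "e p \<in> tangent_plane \<Sigma> p \<inter> contact_plane p" "adapted_metric p (e p) (e p) = 1"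
    using characteristic_field_regular[OF C(1,2), of p] u by (auto simp: p_def)
  then have ep: "e p \<in> contact_plane p"
    by blast
  define w where "w = sqrt (1 + \<alpha>\<^sup>2)"
  have w: "w > 0"
    unfolding w_def by (simp add: add_pos_nonneg)
  have "(\<alpha> *\<^sub>R J p (e p) + Reeb) /\<^sub>R w = a u *\<^sub>R e p + b u *\<^sub>R v"
    using C(7)[OF u] by (simp add: e2_hat_def \<alpha>_def p_def v_def w_def)
  then have eq: "\<alpha> *\<^sub>R J p (e p) + Reeb = w *\<^sub>R (a u *\<^sub>R e p + b u *\<^sub>R v)"
    using w by (metis scaleR_scaleR right_inverse scaleR_one less_irrefl)
  have "fst (e p) * fst (e p) + fst (snd (e p)) * fst (snd (e p)) = 1"
    using reg(2) by (simp add: adapted_metric_contact[OF ep])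
  moreover have "- \<alpha> * fst (snd (e p)) = w * (a u * fst (e p) + b u * fst v)"
    using arg_cong[OF eq, of fst] by (simp add: J_components Reeb_def)
  moreover have "\<alpha> * fst (e p) = w * (a u * fst (snd (e p)) + b u * fst (snd v))"
    using arg_cong[OF eq, of "fst \<circ> snd"] by (simp add: J_components Reeb_def)
  \<comment> \<open>In the third coordinate of \<open>eq\<close> the contact conditions replace the
    last components of \<open>e p\<close> and of \<open>J p (e p)\<close>.\<close>
  moreover have "\<alpha> * (fst (snd p) * fst (J p (e p)) - fst p * fst (snd (J p (e p)))) + 1
      = w * (a u * (fst (snd p) * fst (e p) - fst p * fst (snd (e p))) + b u * snd (snd v))"
    using arg_cong[OF eq, of "snd \<circ> snd"]
    by (simp add: contact_planeD[OF J_contact_plane] contact_planeD[OF ep] Reeb_def)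
  ultimately have *: "w * (a u + b u * (fst v * fst (e p) + fst (snd v) * fst (snd (e p)))) = 0"
    "w * (b u * (fst (snd v) * fst (e p) - fst v * fst (snd (e p)))) = \<alpha>"
    "w * (b u * contact_form p v) = 1"
    unfolding contact_form_expand J_components by algebra+
  show "a u + b u * adapted_metric p v (e p) = 0"
    using *(1) w by (simp add: adapted_metric_contact[OF ep])
  show "b u * contact_form p v * sqrt (1 + \<alpha>\<^sup>2) = 1"
    using *(3) by (simp add: w_def mult_ac)
  have "w * b u \<noteq> 0"
    using *(3) by auto
  moreover have "w * b u * (fst (snd v) * fst (e p) - fst v * fst (snd (e p)))
      = w * b u * (\<alpha> * contact_form p v)"
    unfolding mult.assoc *(2) by (simp only: mult.left_commute[of _ \<alpha>] *(3) mult_1_right)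
  ultimately show "adapted_metric p v (J p (e p)) = \<alpha> * contact_form p v"
    by (simp add: adapted_metric_contact[OF J_contact_plane] J_components)
  have T: "e p \<in> tangent_plane \<Sigma> p" "v \<in> tangent_plane \<Sigma> p" "subspace (tangent_plane \<Sigma> p)"
    using reg(1) smooth_curve_tangent[OF C(1) u] subspace_tangent_plane[OF C(1), of p] u
    by (auto simp: v_def p_def)
  show "\<alpha> *\<^sub>R J p (e p) + Reeb \<in> tangent_plane \<Sigma> p"
    unfolding eq using T by (simp add: subspace_add subspace_scale)
qed

text \<open>As the frame is parallel, vanishing curvature means that the components of \<open>e\<close> are
  constant along the characteristic curves.\<close>

lemma p_minimal_characteristic_constant:
  assumes "p_minimal \<Sigma>" "compatible_coords \<Sigma> e U \<phi> a b" "(x, y) \<in> U"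
  shows "((\<lambda>t. fst (e (\<phi> (t, y)))) has_vector_derivative 0) (at x)"
    "((\<lambda>t. fst (snd (e (\<phi> (t, y))))) has_vector_derivative 0) (at x)"
proof -
  note C = compatible_coordsD[OF assms(2)]
  define p where "p = \<phi> (x, y)"
  define S where "S = {t. (t, y) \<in> U}"
  have "(\<lambda>t. (t, y)) -` U = S"
    by (auto simp: S_def)
  then have S: "open S" "x \<in> S"
    using assms(3) open_vimage[OF C(3), of "\<lambda>t. (t, y)"]
    by (auto simp: S_def continuous_on_Pair)
  have "has_p_mean_curvature \<Sigma> e p 0"
    using assms C(2) unfolding p_minimal_def p_def by blast
  then obtain D where D: "((\<lambda>q. frame_coords q (J q (e q))) has_derivative D) (at p within \<Sigma>)"
    and 0: "0 = of_frame_coords p (D (e p))"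
    unfolding has_p_mean_curvature_def nabla_within_def by auto
  have "D (e p) = 0"
    using arg_cong[OF 0, of "frame_coords p"] by (cases p) (simp add: zero_prod_def)
  then have z: "(\<lambda>t. D (t *\<^sub>R e p)) = (\<lambda>t. 0)"
    by (simp add: linear_scale[OF has_derivative_linear[OF D]])
  have c: "((\<lambda>t. \<phi> (t, y)) has_derivative (\<lambda>t. t *\<^sub>R e p)) (at x within S)"
    using partial_x[OF C(6)[OF assms(3)]] C(5)[OF assms(3)]
    by (simp add: p_def has_vector_derivative_def has_derivative_at_withinI)
  \<comment> \<open>The derivative \<open>D\<close> exists only within the surface, so it is
    restricted to the image of the characteristic curve before the chain rule is applied.\<close>
  have "(\<lambda>t. \<phi> (t, y)) ` S \<subseteq> \<Sigma>"
    using surface_patch_subset[OF C(1)] by (auto simp: S_def)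
  then have "((\<lambda>q. frame_coords q (J q (e q))) has_derivative D)
      (at (\<phi> (x, y)) within (\<lambda>t. \<phi> (t, y)) ` S)"
    using D has_derivative_subset by (simp add: p_def)
  from has_derivative_in_compose[OF c this]
  have "((\<lambda>t. frame_coords (\<phi> (t, y)) (J (\<phi> (t, y)) (e (\<phi> (t, y))))) has_derivative
      (\<lambda>t. 0)) (at x)"
    unfolding z at_within_open[OF S(2,1)] .
  \<comment> \<open>The curvature concerns \<open>J e\<close>, but its frame components are those of
    \<open>e\<close> up to order and sign.\<close>
  moreover have "frame_coords q (J q v) = (- fst (snd v), fst v, 0)" for q v
    by (cases q; cases v) simp
  ultimately have d: "((\<lambda>t. (- fst (snd (e (\<phi> (t, y)))), fst (e (\<phi> (t, y))), 0::real))
      has_derivative (\<lambda>t. 0)) (at x)"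
    by simp
  show "((\<lambda>t. fst (e (\<phi> (t, y)))) has_vector_derivative 0) (at x)"
    using has_derivative_fst[OF has_derivative_snd[OF d]] by (simp add: has_vector_derivative_def)
  show "((\<lambda>t. fst (snd (e (\<phi> (t, y))))) has_vector_derivative 0) (at x)"
    using has_derivative_minus[OF has_derivative_fst[OF d]] by (simp add: has_vector_derivative_def)
qed

text \<open>The horizontal components \<open>(c, s)\<close> of \<open>e\<close> are constant, so the
  curve projects to a straight line in the \<open>xy\<close>-plane. Along it the last component
  \<open>y c - x s\<close> of the contact vector \<open>e\<close> does not change either. Hence
  \<open>e\<close> is constant as a Euclidean vector and the curve is a line in space.\<close>

lemma p_minimal_ruled:
  assumes min: "p_minimal \<Sigma>" and cc: "compatible_coords \<Sigma> e U \<phi> a b"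
    and A: "open A" "connected A" "\<And>t. t \<in> A \<Longrightarrow> (t, y) \<in> U" and x: "x0 \<in> A" "x \<in> A"
  shows "e (\<phi> (x, y)) = e (\<phi> (x0, y))" "\<phi> (x, y) = \<phi> (x0, y) + (x - x0) *\<^sub>R e (\<phi> (x0, y))"
proof -
  note C = compatible_coordsD[OF cc]
  define c where "c = fst (e (\<phi> (x0, y)))"
  define s where "s = fst (snd (e (\<phi> (x0, y))))"
  have cs: "fst (e (\<phi> (t, y))) = c" "fst (snd (e (\<phi> (t, y)))) = s" if "t \<in> A" for t
    unfolding c_def s_def
    using vector_derivative_zero_const[OF A(1,2) p_minimal_characteristic_constant(1)[OF min cc A(3)] that x(1)]
      vector_derivative_zero_const[OF A(1,2) p_minimal_characteristic_constant(2)[OF min cc A(3)] that x(1)]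
    by auto
  have D: "((\<lambda>t. \<phi> (t, y)) has_vector_derivative e (\<phi> (t, y))) (at t)" if "t \<in> A" for t
    using partial_x[OF C(6)[OF A(3)[OF that]]] C(5)[OF A(3)[OF that]] by simp
  have D12: "((\<lambda>t. fst (\<phi> (t, y))) has_vector_derivative c) (at t)"
    "((\<lambda>t. fst (snd (\<phi> (t, y)))) has_vector_derivative s) (at t)" if "t \<in> A" for t
    using bounded_linear.has_vector_derivative[OF bounded_linear_fst D[OF that]]
      bounded_linear.has_vector_derivative[OF bounded_linear_fst
        bounded_linear.has_vector_derivative[OF bounded_linear_snd D[OF that]]] cs[OF that] by auto
  have F1: "fst (\<phi> (t, y)) - t * c = fst (\<phi> (x0, y)) - x0 * c" if "t \<in> A" for t
    by (rule vector_derivative_zero_const[OF A(1,2) _ that x(1)])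
      (auto intro!: derivative_eq_intros D12 simp: has_real_derivative_iff_has_vector_derivative[symmetric]
        D12[unfolded has_real_derivative_iff_has_vector_derivative[symmetric]])
  have F2: "fst (snd (\<phi> (t, y))) - t * s = fst (snd (\<phi> (x0, y))) - x0 * s" if "t \<in> A" for t
    by (rule vector_derivative_zero_const[OF A(1,2) _ that x(1)])
      (auto intro!: derivative_eq_intros D12 simp: has_real_derivative_iff_has_vector_derivative[symmetric]
        D12[unfolded has_real_derivative_iff_has_vector_derivative[symmetric]])
  have "e (\<phi> (t, y)) \<in> contact_plane (\<phi> (t, y))" if "t \<in> A" for t
    using characteristic_field_regular(3)[OF C(1,2)] A(3)[OF that] by blast
  note contact = contact_planeD[OF this]
  \<comment> \<open>A displacement by a multiple of \<open>(c, s)\<close> does not affect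
    \<open>y c - x s\<close>.\<close>
  have e3: "snd (snd (e (\<phi> (t, y)))) = snd (snd (e (\<phi> (x0, y))))" if "t \<in> A" for t
    using contact[OF that] contact[OF x(1)] F1[OF that] F2[OF that]
    unfolding cs[OF that] cs[OF x(1)] by algebra
  have const: "e (\<phi> (t, y)) = e (\<phi> (x0, y))" if "t \<in> A" for t
    by (intro prod_eqI) (simp_all only: cs[OF that] cs[OF x(1)] e3[OF that])
  show "e (\<phi> (x, y)) = e (\<phi> (x0, y))"
    using const x by blast
  have "\<phi> (x, y) - x *\<^sub>R e (\<phi> (x0, y)) = \<phi> (x0, y) - x0 *\<^sub>R e (\<phi> (x0, y))"
  proof (rule vector_derivative_zero_const[OF A(1,2) _ x(2,1)])
    fix t assume "t \<in> A"
    then have "((\<lambda>t. \<phi> (t, y)) has_vector_derivative e (\<phi> (x0, y))) (at t)"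
      using D const by metis
    then show "((\<lambda>t. \<phi> (t, y) - t *\<^sub>R e (\<phi> (x0, y))) has_vector_derivative 0) (at t)"
      by (auto intro!: derivative_eq_intros)
  qed
  then show "\<phi> (x, y) = \<phi> (x0, y) + (x - x0) *\<^sub>R e (\<phi> (x0, y))"
    by (simp add: algebra_simps)
qed

text \<open>In terms of \<open>C = \<Theta>(\<partial>\<^sub>y)\<close>, the second identity is the structure equation \<open>d\<Theta>(e\<^sub>1, J e\<^sub>1) = 2\<close>.\<close>

lemma p_minimal_partial_y:
  assumes min: "p_minimal \<Sigma>" and cc: "compatible_coords \<Sigma> e U \<phi> a b"
    and A: "open A" "connected A" and B: "open B" and AB: "A \<times> B \<subseteq> U"
    and x: "x0 \<in> A" "x \<in> A" and y: "y \<in> B"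
  defines "v \<equiv> \<lambda>x. frechet_derivative \<phi> (at (x, y)) (0, 1)"
  shows "adapted_metric (\<phi> (x, y)) (v x) (e (\<phi> (x, y)))
      = adapted_metric (\<phi> (x0, y)) (v x0) (e (\<phi> (x0, y)))"
    "((\<lambda>t. contact_form (\<phi> (t, y)) (v t)) has_real_derivative
      2 * alpha \<Sigma> e (\<phi> (x, y)) * contact_form (\<phi> (x, y)) (v x)) (at x)"
proof -
  note C = compatible_coordsD[OF cc]
  have U: "(t, z) \<in> U" if "t \<in> A" "z \<in> B" for t z
    using that AB by blast
  define E where "E = (\<lambda>z. e (\<phi> (x0, z)))"
  have ruled: "e (\<phi> (t, z)) = E z" "\<phi> (t, z) = \<phi> (x0, z) + (t - x0) *\<^sub>R E z" if "t \<in> A" "z \<in> B" for t z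
    unfolding E_def using p_minimal_ruled[OF min cc A _ x(1) that(1)] U that(2) by blast+
  \<comment> \<open>This is the mixed derivative of \<open>\<phi>\<close>. Differentiability of
    \<open>E\<close> is read off the smooth map \<open>\<partial>\<^sub>x \<phi>\<close>, which
    equals \<open>e \<circ> \<phi>\<close>.\<close>
  define E' where "E' = frechet_derivative (\<lambda>u. frechet_derivative \<phi> (at u) (1, 0)) (at (x0, y)) (0, 1)"
  have "((\<lambda>z. frechet_derivative \<phi> (at (x0, z)) (1, 0)) has_vector_derivative E') (at y)"
    unfolding E'_def using U[OF x(1) y]
    by (intro partial_y smooth_on_has_derivative[OF smooth_on_frechet_derivative[OF C(4)]]) auto
  then have E': "(E has_vector_derivative E') (at y)"
    by (rule has_vector_derivative_transform_within_open[OF _ B y])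
      (use C(5) U x in \<open>auto simp: E_def\<close>)
  have \<phi>y: "((\<lambda>z. \<phi> (t, z)) has_vector_derivative v t) (at y)" if "t \<in> A" for t
    unfolding v_def using that C(6) U y by (intro partial_y) auto
  \<comment> \<open>Differentiating the ruling in \<open>y\<close> shows that
    \<open>\<partial>\<^sub>y \<phi>\<close> is affine along each characteristic line.\<close>
  have v: "v t = v x0 + (t - x0) *\<^sub>R E'" if "t \<in> A" for t
  proof -
    have "((\<lambda>z. \<phi> (x0, z) + (t - x0) *\<^sub>R E z) has_vector_derivative v x0 + (t - x0) *\<^sub>R E') (at y)"
      by (intro has_vector_derivative_add \<phi>y[OF x(1)]
        bounded_linear.has_vector_derivative[OF bounded_linear_scaleR_right E'])
    then have "((\<lambda>z. \<phi> (t, z)) has_vector_derivative v x0 + (t - x0) *\<^sub>R E') (at y)"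
      by (rule has_vector_derivative_transform_within_open[OF _ B y]) (use ruled that in auto)
    then show ?thesis
      using \<phi>y[OF that] vector_derivative_unique_at by blast
  qed
  have E: "E z \<in> contact_plane (\<phi> (x0, z))" "fst (E z) * fst (E z) + fst (snd (E z)) * fst (snd (E z)) = 1"
    if "z \<in> B" for z
    using characteristic_field_regular[OF C(1,2), of "\<phi> (x0, z)"] U[OF x(1) that]
    by (auto simp: E_def adapted_metric_contact)
  have Ex: "E y \<in> contact_plane (\<phi> (x, y))"
    using characteristic_field_regular(3)[OF C(1,2), of "\<phi> (x, y)"] U[OF x(2) y] ruled(1)[OF x(2) y]
    by auto
  have E1: "((\<lambda>z. fst (E z)) has_real_derivative fst E') (at y)"
    and E2: "((\<lambda>z. fst (snd (E z))) has_real_derivative fst (snd E')) (at y)"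
    and E3: "((\<lambda>z. snd (snd (E z))) has_real_derivative snd (snd E')) (at y)"
    and P1: "((\<lambda>z. fst (\<phi> (x0, z))) has_real_derivative fst (v x0)) (at y)"
    and P2: "((\<lambda>z. fst (snd (\<phi> (x0, z)))) has_real_derivative fst (snd (v x0))) (at y)"
    using E' \<phi>y[OF x(1)]
    by (auto simp: has_real_derivative_iff_has_vector_derivative
        intro!: bounded_linear.has_vector_derivative[OF bounded_linear_fst]
         bounded_linear.has_vector_derivative[OF bounded_linear_snd])
  \<comment> \<open>Differentiating \<open>|E| = 1\<close> makes \<open>E'\<close> horizontally
    orthogonal to \<open>E\<close>; this is why moving along the ruling does not change the
    component of \<open>v\<close> along \<open>e\<close>.\<close>
  have "((\<lambda>z. fst (E z) * fst (E z) + fst (snd (E z)) * fst (snd (E z))) has_real_derivative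
      2 * (fst E' * fst (E y) + fst (snd E') * fst (snd (E y)))) (at y)"
    by (rule derivative_eq_intros E1 E2 refl)+ (simp add: algebra_simps)
  moreover have "((\<lambda>z. fst (E z) * fst (E z) + fst (snd (E z)) * fst (snd (E z))) has_real_derivative 0) (at y)"
    by (rule has_field_derivative_transform_within_open[OF DERIV_const[of 1] B y]) (use E in auto)
  ultimately have orth: "fst E' * fst (E y) + fst (snd E') * fst (snd (E y)) = 0"
    using DERIV_unique by fastforce
  \<comment> \<open>The last component of \<open>E'\<close> comes from differentiating the contact
    condition for \<open>E\<close> in the \<open>y\<close>-direction.\<close>
  have "((\<lambda>z. fst (snd (\<phi> (x0, z))) * fst (E z) - fst (\<phi> (x0, z)) * fst (snd (E z)))
      has_real_derivative fst (snd (v x0)) * fst (E y) + fst (snd (\<phi> (x0, y))) * fst E'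
       - fst (v x0) * fst (snd (E y)) - fst (\<phi> (x0, y)) * fst (snd E')) (at y)"
    by (rule derivative_eq_intros E1 E2 P1 P2 refl)+ (simp add: algebra_simps)
  moreover have "((\<lambda>z. fst (snd (\<phi> (x0, z))) * fst (E z) - fst (\<phi> (x0, z)) * fst (snd (E z)))
      has_real_derivative snd (snd E')) (at y)"
    by (rule has_field_derivative_transform_within_open[OF E3 B y]) (use E(1) contact_planeD in auto)
  ultimately have k': "snd (snd E') = fst (snd (v x0)) * fst (E y) + fst (snd (\<phi> (x0, y))) * fst E'
       - fst (v x0) * fst (snd (E y)) - fst (\<phi> (x0, y)) * fst (snd E')"
    using DERIV_unique by blast
  show "adapted_metric (\<phi> (x, y)) (v x) (e (\<phi> (x, y)))
      = adapted_metric (\<phi> (x0, y)) (v x0) (e (\<phi> (x0, y)))"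
    unfolding ruled(1)[OF x(1) y] ruled(1)[OF x(2) y] adapted_metric_contact[OF Ex]
      adapted_metric_contact[OF E(1)[OF y]] v[OF x(2)]
    using orth by simp algebra
  define g where "g = \<phi> (x0, y)"
  have cf: "contact_form (\<phi> (t, y)) (v t) = (snd (snd (v x0)) + (t - x0) * snd (snd E'))
      + (fst g + (t - x0) * fst (E y)) * (fst (snd (v x0)) + (t - x0) * fst (snd E'))
      - (fst (snd g) + (t - x0) * fst (snd (E y))) * (fst (v x0) + (t - x0) * fst E')" if "t \<in> A" for t
    unfolding contact_form_expand ruled(2)[OF that y] v[OF that] g_def by simp
  \<comment> \<open>The area term \<open>v\<^sub>2 E\<^sub>1 - v\<^sub>1 E\<^sub>2\<close> arises
    once from moving the base point along \<open>E\<close> and once through \<open>k'\<close>, at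
    \<open>x0\<close>. The terms quadratic in \<open>E\<close> and \<open>E'\<close> combine so that
    both count at \<open>x\<close>, which gives the factor 2.\<close>
  have d: "((\<lambda>t. (snd (snd (v x0)) + (t - x0) * snd (snd E'))
      + (fst g + (t - x0) * fst (E y)) * (fst (snd (v x0)) + (t - x0) * fst (snd E'))
      - (fst (snd g) + (t - x0) * fst (snd (E y))) * (fst (v x0) + (t - x0) * fst E'))
      has_real_derivative 2 * (fst (snd (v x)) * fst (E y) - fst (v x) * fst (snd (E y)))) (at x)"
    by (rule derivative_eq_intros refl)+ (simp add: v[OF x(2)] k' g_def algebra_simps)
  have r: "fst (snd (v x)) * fst (E y) - fst (v x) * fst (snd (E y))
      = alpha \<Sigma> e (\<phi> (x, y)) * contact_form (\<phi> (x, y)) (v x)"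
    using compatible_coords_relations(2)[OF cc U[OF x(2) y]]
    by (simp add: adapted_metric_contact[OF J_contact_plane] J_components ruled(1)[OF x(2) y] v_def)
  show "((\<lambda>t. contact_form (\<phi> (t, y)) (v t)) has_real_derivative
      2 * alpha \<Sigma> e (\<phi> (x, y)) * contact_form (\<phi> (x, y)) (v x)) (at x)"
    using has_field_derivative_transform_within_open[OF d A(1) x(2) cf[symmetric]]
    by (simp only: r mult.assoc)
qed

section \<open>Changes of coordinates\<close>

lemma smooth_antiderivative_exists:
  fixes f :: "real \<Rightarrow> real"
  assumes "smooth_on {l<..<r} f" "l < r"
  obtains F where "smooth_on {l<..<r} F"
    "\<And>x. x \<in> {l<..<r} \<Longrightarrow> (F has_real_derivative f x) (at x)"
proof -
  have "isCont f x" if "x \<in> {l<..<r}" for x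
    using smooth_on_continuous_on[OF assms(1)] that continuous_on_eq_continuous_at[of "{l<..<r}" f]
    by auto
  then have "\<exists>F. \<forall>x::real. ereal l < x \<longrightarrow> x < ereal r \<longrightarrow> (F has_vector_derivative f x) (at x)"
    using assms(2) by (intro einterval_antiderivative) auto
  then obtain F where F: "\<And>x. x \<in> {l<..<r} \<Longrightarrow> (F has_real_derivative f x) (at x)"
    by (auto simp: has_real_derivative_iff_has_vector_derivative)
  moreover have "smooth_on {l<..<r} F"
    using smooth_on_antiderivative[OF _ F assms(1)] by simp
  ultimately show ?thesis
    using that by blast
qed

text \<open>\<open>\<Psi>\<close> is an antiderivative of \<open>d\<close>, hence strictly
  increasing; its image \<open>N\<close> is open by invariance of domain. The derivative is recorded
  for the inverse \<open>h\<close>, because charts are represented by the inverses of coordinate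
  maps.\<close>

lemma smooth_increasing_coordinate:
  fixes d :: "real \<Rightarrow> real"
  assumes "smooth_on {l<..<r} d" "l < r" "\<And>y. y \<in> {l<..<r} \<Longrightarrow> d y > 0"
  obtains \<Psi> h N where "open N" "continuous_on {l<..<r} \<Psi>" "smooth_on N h"
    "\<And>y. y \<in> {l<..<r} \<Longrightarrow> \<Psi> y \<in> N \<and> h (\<Psi> y) = y"
    "\<And>z. z \<in> N \<Longrightarrow> h z \<in> {l<..<r} \<and> \<Psi> (h z) = z"
    "\<And>z. z \<in> N \<Longrightarrow> (h has_real_derivative 1 / d (h z)) (at z)"
proof -
  let ?I = "{l<..<r}"
  obtain \<Psi> where \<Psi>: "smooth_on ?I \<Psi>" "\<And>x. x \<in> ?I \<Longrightarrow> (\<Psi> has_real_derivative d x) (at x)"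
    using smooth_antiderivative_exists[OF assms(1,2)] by blast
  have "\<Psi> x < \<Psi> y" if "x \<in> ?I" "y \<in> ?I" "x < y" for x y
  proof (rule DERIV_pos_imp_increasing[OF that(3)])
    fix z assume "x \<le> z" "z \<le> y"
    then have "z \<in> ?I"
      using that by auto
    then show "\<exists>y. (\<Psi> has_real_derivative y) (at z) \<and> y > 0"
      using \<Psi>(2) assms(3) by blast
  qed
  then have inj: "inj_on \<Psi> ?I"
    by (intro linorder_inj_onI') force
  have cont: "continuous_on ?I \<Psi>"
    using \<Psi>(1) by (rule smooth_on_continuous_on)
  define h where "h = inv_into ?I \<Psi>"
  have N: "open (\<Psi> ` ?I)"
    using invariance_of_domain[OF cont _ inj] by simp
  have h: "h (\<Psi> y) = y" if "y \<in> ?I" for y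
    unfolding h_def using inj that by (rule inv_into_f_f)
  have h2: "h z \<in> ?I" "\<Psi> (h z) = z" if "z \<in> \<Psi> ` ?I" for z
    using that h by auto
  have dh: "(h has_real_derivative 1 / d (h z)) (at z)" if "z \<in> \<Psi> ` ?I" for z
  proof -
    have "(h has_derivative (*) (1 / d (h z))) (at z)"
    proof (rule has_derivative_inverse_strong_x[where S = ?I and f = \<Psi> and g = h and f' = "(*) (d (h z))"])
      show "(\<Psi> has_derivative (*) (d (h z))) (at (h z))"
        using \<Psi>(2)[OF h2(1)[OF that]] by (simp add: has_field_derivative_def)
      show "(*) (d (h z)) \<circ> (*) (1 / d (h z)) = id"
        using assms(3)[OF h2(1)[OF that]] by (auto simp: fun_eq_iff)
    qed (use h h2[OF that] cont in auto)
    then show ?thesis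
      by (simp add: has_field_derivative_def)
  qed
  have "smooth_on (\<Psi> ` ?I) h"
    by (rule smooth_on_inverse_function[OF N dh _ assms(1)]) (use h2 assms(3) in \<open>force+\<close>)
  then show ?thesis
    using that[OF N cont] h h2 dh by blast
qed

text \<open>The new chart has \<open>\<partial>\<^sub>x = s e\<close> and
  \<open>\<partial>\<^sub>y = - f' e + h' \<partial>\<^sub>y \<phi>\<close>. The second frame vector
  is the same for \<open>e\<close> and \<open>s e\<close>, so its new coefficients are obtained by
  solving a triangular linear system. Taking \<open>h' > 0\<close> keeps the second coefficient
  positive for either sign.\<close>

lemma compatible_coords_reparam:
  fixes f h f' h' :: "real \<Rightarrow> real" and s :: real
  assumes cc: "compatible_coords \<Sigma> e U \<phi> a b"
    and AB: "open A" "open B" "A \<times> B \<subseteq> U"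
    and W: "characteristic_field \<Sigma> W e1" "\<phi> ` (A \<times> B) \<subseteq> W"
    and s: "s * s = 1" "\<And>u. u \<in> A \<times> B \<Longrightarrow> e1 (\<phi> u) = s *\<^sub>R e (\<phi> u)"
    and N: "open N" "smooth_on N h" "\<And>z. z \<in> N \<Longrightarrow> (h has_real_derivative h' z) (at z)"
      "\<And>z. z \<in> N \<Longrightarrow> h' z > 0"
    and \<Psi>: "continuous_on B \<Psi>" "\<And>y. y \<in> B \<Longrightarrow> \<Psi> y \<in> N \<and> h (\<Psi> y) = y"
      "\<And>z. z \<in> N \<Longrightarrow> h z \<in> B \<and> \<Psi> (h z) = z"
    and f: "smooth_on N f" "\<And>z. z \<in> N \<Longrightarrow> (f has_real_derivative f' z) (at z)"
  defines "G \<equiv> \<lambda>u. (s * fst u - f (snd u), h (snd u))"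
    and "U' \<equiv> {u. snd u \<in> N \<and> s * fst u - f (snd u) \<in> A}"
  shows "G ` U' = A \<times> B"
    "compatible_coords \<Sigma> e1 U' (\<phi> \<circ> G)
       (\<lambda>u. s * (a (G u) + b (G u) * f' (snd u) / h' (snd u))) (\<lambda>u. b (G u) / h' (snd u))"
    "\<And>u. u \<in> U' \<Longrightarrow> alpha \<Sigma> e1 (\<phi> (G u)) = s * alpha \<Sigma> e (\<phi> (G u))"
proof -
  note C = compatible_coordsD[OF cc]
  \<comment> \<open>This is the inverse of \<open>G\<close>: the sign \<open>s\<close> is its own
    inverse and \<open>\<Psi>\<close> inverts \<open>h\<close>.\<close>
  define F where "F = (\<lambda>u. (s * (fst u + f (\<Psi> (snd u))), \<Psi> (snd u)))"
  have ss: "s * (s * t) = t" for t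
    using s(1) by (metis mult.assoc mult_1)
  have s0: "s \<noteq> 0"
    using s(1) by auto
  have GF: "F u \<in> U'" "G (F u) = u" if "u \<in> A \<times> B" for u
    using that \<Psi>(2)[of "snd u"] by (auto simp: F_def G_def U'_def ss)
  have FG: "G u \<in> A \<times> B" "F (G u) = u" if "u \<in> U'" for u
    using that \<Psi>(3)[of "snd u"] by (auto simp: F_def G_def U'_def ss)
  show G: "G ` U' = A \<times> B"
  proof
    show "A \<times> B \<subseteq> G ` U'"
    proof
      fix u assume "u \<in> A \<times> B"
      then have "u = G (F u)" "F u \<in> U'"
        using GF by simp_all
      then show "u \<in> G ` U'"
        by (rule image_eqI)
    qed
  qed (use FG(1) in blast)
  have UNJ: "open (UNIV \<times> N :: (real \<times> real) set)"
    using N(1) by (simp add: open_Times)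
  have smG: "smooth_on (UNIV \<times> N) G"
    unfolding G_def
    by (intro smooth_on_Pair smooth_on_diff smooth_on_mult smooth_on_const UNJ
      smooth_on_linear[OF bounded_linear_fst] smooth_on_compose[OF UNJ f(1)]
      smooth_on_compose[OF UNJ N(2)] smooth_on_linear[OF bounded_linear_snd]) auto
  have sub: "U' \<subseteq> UNIV \<times> N"
    by (auto simp: U'_def)
  have smG': "smooth_on U' G"
    using smG sub by (rule smooth_on_subset)
  have "U' = (UNIV \<times> N) \<inter> G -` (A \<times> UNIV)"
    by (auto simp: U'_def G_def)
  then have opU': "open U'"
    using continuous_open_preimage[OF smooth_on_continuous_on[OF smG] UNJ, of "A \<times> UNIV"] AB(1)
    by (simp add: open_Times)
  have contf: "continuous_on N f"
    using f(1) by (rule smooth_on_continuous_on)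
  have "continuous_on (A \<times> B) (\<lambda>u. \<Psi> (snd u))"
    by (rule continuous_on_compose2[OF \<Psi>(1)]) (auto intro!: continuous_intros)
  moreover from this have "continuous_on (A \<times> B) (\<lambda>u. f (\<Psi> (snd u)))"
    by (rule continuous_on_compose2[OF contf]) (use \<Psi>(2) in auto)
  ultimately have contF: "continuous_on (A \<times> B) F"
    unfolding F_def by (intro continuous_intros)
  have homG: "homeomorphism U' (A \<times> B) G F"
    by (rule homeomorphismI[OF smooth_on_continuous_on[OF smG'] contF])
      (use GF FG G in \<open>blast+\<close>)
  obtain \<psi> where \<psi>: "homeomorphism U (\<phi> ` U) \<phi> \<psi>"
    using C(1) by (auto simp: surface_patch_def)
  have hom: "homeomorphism U' (\<phi> ` (A \<times> B)) (\<phi> \<circ> G) (F \<circ> \<psi>)"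
    by (rule homeomorphism_compose[OF homG homeomorphism_of_subsets[OF \<psi> AB(3) order_refl refl]])
  have op: "openin (top_of_set \<Sigma>) (\<phi> ` (A \<times> B))"
  proof (rule openin_trans)
    show "openin (top_of_set (\<phi> ` U)) (\<phi> ` (A \<times> B))"
      by (rule homeomorphism_imp_open_map[OF \<psi>])
        (use AB in \<open>simp add: open_Times open_openin_trans openin_open_eq C(3)\<close>)
    show "openin (top_of_set \<Sigma>) (\<phi> ` U)"
      using C(1) by (simp add: surface_patch_def)
  qed
  have im: "(\<phi> \<circ> G) ` U' = \<phi> ` (A \<times> B)"
    unfolding image_comp[symmetric] G ..
  have GU: "G u \<in> U" if "u \<in> U'" for u
    by (rule subsetD[OF AB(3) FG(1)[OF that]])
  have dG: "(G has_derivative (\<lambda>v. (s * fst v - f' (snd u) * snd v, h' (snd u) * snd v))) (at u)"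
    if "u \<in> U'" for u
  proof -
    have N': "snd u \<in> N"
      using that by (simp add: U'_def)
    have "((\<lambda>u. f (snd u)) has_derivative (\<lambda>v. f' (snd u) * snd v)) (at u)"
      by (rule has_derivative_compose[OF has_derivative_snd[OF has_derivative_ident]
          f(2)[OF N', unfolded has_field_derivative_def]])
    moreover have "((\<lambda>u. h (snd u)) has_derivative (\<lambda>v. h' (snd u) * snd v)) (at u)"
      by (rule has_derivative_compose[OF has_derivative_snd[OF has_derivative_ident]
          N(3)[OF N', unfolded has_field_derivative_def]])
    ultimately show ?thesis
      unfolding G_def by (intro has_derivative_Pair has_derivative_diff has_derivative_mult_right
          has_derivative_fst has_derivative_ident)
  qed
  have d\<phi>: "frechet_derivative (\<phi> \<circ> G) (at u) = (\<lambda>v. frechet_derivative \<phi> (at (G u))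
      (s * fst v - f' (snd u) * snd v, h' (snd u) * snd v))" if "u \<in> U'" for u
    unfolding comp_def
    by (rule frechet_derivative_at[OF has_derivative_compose[OF dG[OF that] C(6)[OF GU[OF that]]], symmetric])
  have lin: "linear (frechet_derivative \<phi> (at (G u)))" if "u \<in> U'" for u
    using has_derivative_linear[OF C(6)[OF GU[OF that]]] .
  have "inj (frechet_derivative (\<phi> \<circ> G) (at u))" if "u \<in> U'" for u
  proof -
    have N': "h' (snd u) > 0"
      using that N(4) by (simp add: U'_def)
    have "inj (frechet_derivative \<phi> (at (G u)))"
      using C(1) GU[OF that] by (auto simp: surface_patch_def)
    moreover have "inj (\<lambda>v::real \<times> real. (s * fst v - f' (snd u) * snd v, h' (snd u) * snd v))"
      using N' s0 by (intro injI) (auto simp: prod_eq_iff)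
    ultimately show ?thesis
      unfolding d\<phi>[OF that] by (rule inj_compose[unfolded comp_def])
  qed
  moreover have "smooth_on U' (\<phi> \<circ> G)"
    unfolding comp_def by (rule smooth_on_compose[OF opU' C(4) smG']) (use GU in auto)
  ultimately have patch: "surface_patch \<Sigma> U' (\<phi> \<circ> G)"
    unfolding surface_patch_def im using opU' op hom by blast
  have char: "characteristic_field \<Sigma> ((\<phi> \<circ> G) ` U') e1"
    using W op unfolding im characteristic_field_def smooth_along_def by blast
  have Js: "J (\<phi> (G u)) (e1 (\<phi> (G u))) = s *\<^sub>R J (\<phi> (G u)) (e (\<phi> (G u)))" if "u \<in> U'" for u
    using s(2)[OF FG(1)[OF that]]
    by (cases "\<phi> (G u)"; cases "e (\<phi> (G u))") (simp add: algebra_simps)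
  have ss': "s * t * s = t" for t
    using ss by (simp add: mult.commute)
  show \<alpha>: "alpha \<Sigma> e1 (\<phi> (G u)) = s * alpha \<Sigma> e (\<phi> (G u))" if "u \<in> U'" for u
  proof -
    have p: "\<phi> (G u) \<in> (\<phi> \<circ> G) ` U'"
      using that by auto
    \<comment> \<open>The sign occurs twice and cancels, so this is the tangent vector that defines
      \<alpha> for \<open>e\<close>.\<close>
    have "(s * alpha \<Sigma> e (\<phi> (G u))) *\<^sub>R J (\<phi> (G u)) (e1 (\<phi> (G u))) + Reeb
        \<in> tangent_plane \<Sigma> (\<phi> (G u))"
      unfolding Js[OF that] scaleR_scaleR ss' by (rule compatible_coords_relations(4)[OF cc GU[OF that]])
    then show ?thesis
      by (rule alpha_eqI[where e = e1, OF subspace_tangent_plane(1)[OF patch p]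
        characteristic_field_regular(5)[OF patch char p p]])
  qed
  have e2: "e2_hat \<Sigma> e1 (\<phi> (G u)) = e2_hat \<Sigma> e (\<phi> (G u))" if "u \<in> U'" for u
    using s(1) by (simp add: e2_hat_def \<alpha>[OF that] Js[OF that] ss' power_mult_distrib power2_eq_square[of s])
  have Dx: "frechet_derivative (\<phi> \<circ> G) (at u) (1, 0) = s *\<^sub>R e (\<phi> (G u))" if "u \<in> U'" for u
    unfolding d\<phi>[OF that] C(5)[OF GU[OF that], symmetric]
    using linear_scale[OF lin[OF that], of s "(1, 0)"] by simp
  have Dy: "frechet_derivative (\<phi> \<circ> G) (at u) (0, 1)
      = - f' (snd u) *\<^sub>R e (\<phi> (G u)) + h' (snd u) *\<^sub>R frechet_derivative \<phi> (at (G u)) (0, 1)"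
    if "u \<in> U'" for u
  proof -
    have "(- f' (snd u), h' (snd u)) = - f' (snd u) *\<^sub>R (1, 0) + h' (snd u) *\<^sub>R (0, 1::real)"
      by simp
    then show ?thesis
      unfolding d\<phi>[OF that] C(5)[OF GU[OF that], symmetric]
      by (simp only: linear_add[OF lin[OF that]] linear_scale[OF lin[OF that]] fst_conv snd_conv
        mult_zero_right mult_1_right diff_0)
  qed
  show "compatible_coords \<Sigma> e1 U' (\<phi> \<circ> G)
       (\<lambda>u. s * (a (G u) + b (G u) * f' (snd u) / h' (snd u))) (\<lambda>u. b (G u) / h' (snd u))"
    unfolding compatible_coords_def
  proof (intro conjI ballI patch char)
    fix u assume u: "u \<in> U'"
    have h': "h' (snd u) > 0"
      using u N(4) by (simp add: U'_def)
    show "e1 ((\<phi> \<circ> G) u) = frechet_derivative (\<phi> \<circ> G) (at u) (1, 0)"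
      using Dx[OF u] s(2)[OF FG(1)[OF u]] by simp
    show "0 < b (G u) / h' (snd u)"
      using C(8)[OF GU[OF u]] h' by simp
    have "(s * (a (G u) + b (G u) * f' (snd u) / h' (snd u))) *\<^sub>R s *\<^sub>R e (\<phi> (G u)) +
        (b (G u) / h' (snd u)) *\<^sub>R (- f' (snd u) *\<^sub>R e (\<phi> (G u))
           + h' (snd u) *\<^sub>R frechet_derivative \<phi> (at (G u)) (0, 1))
      = a (G u) *\<^sub>R e (\<phi> (G u)) + b (G u) *\<^sub>R frechet_derivative \<phi> (at (G u)) (0, 1)"
      using h' by (simp add: algebra_simps ss)
    then show "e2_hat \<Sigma> e1 ((\<phi> \<circ> G) u) =
        (s * (a (G u) + b (G u) * f' (snd u) / h' (snd u))) *\<^sub>R frechet_derivative (\<phi> \<circ> G) (at u) (1, 0) +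
        (b (G u) / h' (snd u)) *\<^sub>R frechet_derivative (\<phi> \<circ> G) (at u) (0, 1)"
      unfolding Dx[OF u] Dy[OF u] comp_apply e2[OF u] C(7)[OF GU[OF u]] by (rule sym)
  qed
qed

section \<open>Comparison of two characteristic fields near a point\<close>

lemma smooth_along_continuous_on:
  assumes "smooth_along W f"
  shows "continuous_on W f"
  unfolding continuous_on_eq_continuous_within
proof
  fix p assume p: "p \<in> W"
  then obtain V F where V: "open V" "p \<in> V" "smooth_on V F" "\<And>q. q \<in> W \<inter> V \<Longrightarrow> F q = f q"
    using bspec[OF assms[unfolded smooth_along_def] p] by (elim exE conjE) auto
  have "isCont F p"
    using smooth_on_continuous_on[OF V(3)] V(2) by (simp add: continuous_on_eq_continuous_at[OF V(1)])
  then have "continuous (at p within W \<inter> V) F"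
    by (rule continuous_at_imp_continuous_at_within)
  then have "continuous (at p within W \<inter> V) f"
    by (rule continuous_transform_within[OF _ zero_less_one]) (use p V in auto)
  moreover have "at p within W \<inter> V = at p within W"
    by (rule at_within_nhd[OF V(2,1)]) auto
  ultimately show "continuous (at p within W) f"
    by simp
qed

lemma open_contains_square:
  fixes V :: "(real \<times> real) set"
  assumes "open V" "(x, y) \<in> V"
  obtains \<epsilon> where "\<epsilon> > 0" "{x - \<epsilon><..<x + \<epsilon>} \<times> {y - \<epsilon><..<y + \<epsilon>} \<subseteq> V"
proof -
  obtain A B where AB: "open A" "open B" "x \<in> A" "y \<in> B" "A \<times> B \<subseteq> V"
    using open_prod_elim[OF assms] by (metis mem_Sigma_iff)
  obtain \<delta> where \<delta>: "\<delta> > 0" "ball x \<delta> \<subseteq> A"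
    using AB openE by blast
  obtain \<eta> where \<eta>: "\<eta> > 0" "ball y \<eta> \<subseteq> B"
    using AB openE by blast
  have "{x - min \<delta> \<eta><..<x + min \<delta> \<eta>} \<subseteq> A" "{y - min \<delta> \<eta><..<y + min \<delta> \<eta>} \<subseteq> B"
    by (rule order.trans[OF _ \<delta>(2)], auto simp: dist_real_def)
      (rule subsetD[OF \<eta>(2)], auto simp: dist_real_def)
  then show ?thesis
    using that[of "min \<delta> \<eta>"] \<delta>(1) \<eta>(1) AB(5) by (meson Sigma_mono min_less_iff_conj subset_trans)
qed

lemma connected_nonzero_sgn_const:
  fixes g :: "'a::topological_space \<Rightarrow> real"
  assumes "connected S" "continuous_on S g" "\<And>u. u \<in> S \<Longrightarrow> g u \<noteq> 0" "u \<in> S" "v \<in> S"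
  shows "sgn (g u) = sgn (g v)"
proof -
  have "continuous_on S (\<lambda>u. sgn (g u))"
    using assms(2,3) by (intro continuous_on_sgn) auto
  moreover have "(\<lambda>u. sgn (g u)) ` S \<subseteq> {-1, 0, 1}"
    by (auto simp: sgn_if)
  then have "finite ((\<lambda>u. sgn (g u)) ` S)"
    using finite_subset by blast
  ultimately have "(\<lambda>u. sgn (g u)) constant_on S"
    using continuous_finite_range_constant[OF assms(1)] by blast
  then show ?thesis
    using assms(4,5) unfolding constant_on_def by metis
qed

text \<open>Both fields are unit vectors on the same line, so their ratio \<open>g\<close> is 1 or
  -1 at each point. Being continuous, it is constant on a connected square.\<close>

lemma characteristic_fields_agree:
  assumes cc: "compatible_coords \<Sigma> e U \<phi> a b" and U: "(x, y) \<in> U"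
    and W: "characteristic_field \<Sigma> W e1" "\<phi> (x, y) \<in> W"
  obtains \<epsilon> s where "\<epsilon> > 0" "{x - \<epsilon><..<x + \<epsilon>} \<times> {y - \<epsilon><..<y + \<epsilon>} \<subseteq> U"
    "\<phi> ` ({x - \<epsilon><..<x + \<epsilon>} \<times> {y - \<epsilon><..<y + \<epsilon>}) \<subseteq> W" "s = 1 \<or> s = - 1"
    "\<And>u. u \<in> {x - \<epsilon><..<x + \<epsilon>} \<times> {y - \<epsilon><..<y + \<epsilon>} \<Longrightarrow> e1 (\<phi> u) = s *\<^sub>R e (\<phi> u)"
proof -
  note C = compatible_coordsD[OF cc]
  have cont: "continuous_on U \<phi>"
    using C(4) by (rule smooth_on_continuous_on)
  obtain T where T: "open T" "W = \<Sigma> \<inter> T"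
    using W(1) by (auto simp: characteristic_field_def openin_open)
  define V where "V = U \<inter> \<phi> -` T"
  have V: "open V" "(x, y) \<in> V"
    unfolding V_def using continuous_open_preimage[OF cont C(3) T(1)] U W(2) T(2) by auto
  have VW: "u \<in> U" "\<phi> u \<in> W" if "u \<in> V" for u
    using that surface_patch_subset[OF C(1)] T(2) by (auto simp: V_def)
  define g where "g = (\<lambda>u. adapted_metric (\<phi> u) (e1 (\<phi> u)) (e (\<phi> u)))"
  have g: "e1 (\<phi> u) = g u *\<^sub>R e (\<phi> u)" "\<bar>g u\<bar> = 1" if "u \<in> V" for u
  proof -
    have p: "\<phi> u \<in> \<phi> ` U"
      using VW(1)[OF that] by blast
    note r = characteristic_field_regular[OF C(1,2) p p]
    note r1 = characteristic_field_regular[OF C(1) W(1) p VW(2)[OF that]]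
    show "e1 (\<phi> u) = g u *\<^sub>R e (\<phi> u)" "\<bar>g u\<bar> = 1"
      unfolding g_def
      using characteristic_direction_unique[OF subspace_tangent_plane[OF C(1) p] r(1,2,3,4) r1(3,4)]
      by blast+
  qed
  have geq: "g u = fst (e1 (\<phi> u)) * fst (frechet_derivative \<phi> (at u) (1, 0))
      + fst (snd (e1 (\<phi> u))) * fst (snd (frechet_derivative \<phi> (at u) (1, 0)))" if "u \<in> V" for u
    using characteristic_field_regular(3)[OF C(1,2), of "\<phi> u"] VW(1)[OF that]
    by (auto simp: g_def adapted_metric_contact C(5))
  have "continuous_on V (\<lambda>u. e1 (\<phi> u))"
    by (rule continuous_on_compose2[OF smooth_along_continuous_on[of W e1]
        continuous_on_subset[OF cont] image_subsetI[OF VW(2)]])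
      (use W(1) in \<open>auto simp: characteristic_field_def V_def\<close>)
  moreover have "continuous_on V (\<lambda>u. frechet_derivative \<phi> (at u) (1, 0))"
    by (rule continuous_on_subset[OF smooth_on_continuous_on[OF smooth_on_frechet_derivative[OF C(4)]]])
      (auto simp: V_def)
  ultimately have "continuous_on V (\<lambda>u. fst (e1 (\<phi> u)) * fst (frechet_derivative \<phi> (at u) (1, 0))
      + fst (snd (e1 (\<phi> u))) * fst (snd (frechet_derivative \<phi> (at u) (1, 0))))"
    by (intro continuous_intros)
  then have contg: "continuous_on V g"
    by (rule continuous_on_eq) (simp add: geq)
  obtain \<epsilon> where \<epsilon>: "\<epsilon> > 0" "{x - \<epsilon><..<x + \<epsilon>} \<times> {y - \<epsilon><..<y + \<epsilon>} \<subseteq> V" (is "?Q \<subseteq> V")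
    using open_contains_square[OF V] by blast
  have conn: "connected ?Q"
    by (intro convex_connected convex_Times) auto
  have xy: "(x, y) \<in> ?Q"
    using \<epsilon>(1) by simp
  have "g u = g (x, y)" if "u \<in> ?Q" for u
  proof -
    have "sgn (g u) = sgn (g (x, y))"
    proof (rule connected_nonzero_sgn_const[OF conn continuous_on_subset[OF contg \<epsilon>(2)] _ that xy])
      fix u assume "u \<in> ?Q"
      then show "g u \<noteq> 0"
        using g(2) \<epsilon>(2) by fastforce
    qed
    then show ?thesis
      using g(2)[of u] g(2)[of "(x, y)"] that xy \<epsilon>(2) by (auto simp: subset_iff sgn_if split: if_splits)
  qed
  then have s: "e1 (\<phi> u) = g (x, y) *\<^sub>R e (\<phi> u)" if "u \<in> ?Q" for u
    using g(1)[of u] \<epsilon>(2) that by (metis subsetD)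
  show ?thesis
  proof (rule that[OF \<epsilon>(1) _ _ _ s])
    show "?Q \<subseteq> U" "\<phi> ` ?Q \<subseteq> W"
      using \<epsilon>(2) VW by blast+
    show "g (x, y) = 1 \<or> g (x, y) = - 1"
      using g(2)[OF V(2)] by linarith
  qed assumption
qed

text \<open>The three types are treated at once: \<open>q\<close> is a solution of \<open>\<partial>\<^sub>x q = 2 \<alpha> q\<close>, an equation that
  \<open>\<Theta>(\<partial>\<^sub>y)\<close> satisfies as well, so the two are proportional by a function of \<open>y\<close> alone, which is
  absorbed into the coordinate \<open>y\<close>.\<close>

lemma normalized_coords:
  assumes min: "p_minimal \<Sigma>" and cc: "compatible_coords \<Sigma> e U \<phi> a b" and U: "(x0, y0) \<in> U"
    and W: "characteristic_field \<Sigma> W e1" "\<phi> (x0, y0) \<in> W"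
    and q: "smooth_on U q" "\<And>u. u \<in> U \<Longrightarrow> q u \<noteq> 0"
      "\<And>x y. (x, y) \<in> U \<Longrightarrow>
         ((\<lambda>t. q (t, y)) has_real_derivative 2 * alpha \<Sigma> e (\<phi> (x, y)) * q (x, y)) (at x)"
  obtains s f h U' b' where "s = 1 \<or> s = - 1"
    "open (snd ` U')" "smooth_on (snd ` U') f" "smooth_on (snd ` U') h"
    "\<And>x y. (x, y) \<in> U' \<Longrightarrow> (s * x - f y, h y) \<in> U"
    "\<phi> (x0, y0) \<in> (\<lambda>(x, y). \<phi> (s * x - f y, h y)) ` U'"
    "(\<lambda>(x, y). \<phi> (s * x - f y, h y)) ` U' \<subseteq> W"
    "orthogonal_coords \<Sigma> e1 U' (\<lambda>(x, y). \<phi> (s * x - f y, h y)) (\<lambda>_. 0) b'"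
    "\<And>x y. (x, y) \<in> U' \<Longrightarrow>
       alpha \<Sigma> e1 (\<phi> (s * x - f y, h y)) = s * alpha \<Sigma> e (\<phi> (s * x - f y, h y))"
    "\<And>x y. (x, y) \<in> U' \<Longrightarrow> b' (x, y) = 1 / \<bar>q (s * x - f y, h y)\<bar>
       / sqrt (1 + (alpha \<Sigma> e1 (\<phi> (s * x - f y, h y)))\<^sup>2)"
proof -
  note C = compatible_coordsD[OF cc]
  obtain \<epsilon> s where \<epsilon>: "\<epsilon> > 0" and AB: "{x0 - \<epsilon><..<x0 + \<epsilon>} \<times> {y0 - \<epsilon><..<y0 + \<epsilon>} \<subseteq> U"
    and \<phi>W: "\<phi> ` ({x0 - \<epsilon><..<x0 + \<epsilon>} \<times> {y0 - \<epsilon><..<y0 + \<epsilon>}) \<subseteq> W" and s: "s = 1 \<or> s = - 1"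
    and e1: "\<And>u. u \<in> {x0 - \<epsilon><..<x0 + \<epsilon>} \<times> {y0 - \<epsilon><..<y0 + \<epsilon>} \<Longrightarrow> e1 (\<phi> u) = s *\<^sub>R e (\<phi> u)"
    using characteristic_fields_agree[OF cc U W] by blast
  let ?A = "{x0 - \<epsilon><..<x0 + \<epsilon>}" and ?B = "{y0 - \<epsilon><..<y0 + \<epsilon>}"
  have ss: "s * s = 1"
    using s by auto
  have x0: "x0 \<in> ?A" and y0: "y0 \<in> ?B"
    using \<epsilon> by auto
  define \<phi>x where "\<phi>x = (\<lambda>u. frechet_derivative \<phi> (at u) (1, 0))"
  define \<phi>y where "\<phi>y = (\<lambda>u. frechet_derivative \<phi> (at u) (0, 1))"
  define c where "c = (\<lambda>u. contact_form (\<phi> u) (\<phi>y u))"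
  define k where "k = (\<lambda>u. adapted_metric (\<phi> u) (\<phi>y u) (e (\<phi> u)))"
  define w where "w = (\<lambda>u. sqrt (1 + (alpha \<Sigma> e (\<phi> u))\<^sup>2))"
  have w: "w u > 0" for u
    unfolding w_def by (simp add: add_pos_nonneg)
  have rel: "a u + b u * k u = 0" "b u * c u * w u = 1" if "u \<in> U" for u
    using compatible_coords_relations(1,3)[OF cc that] by (simp_all add: k_def c_def w_def \<phi>y_def)
  \<comment> \<open>Positivity of \<open>b\<close> and \<open>w\<close> in \<open>b c w = 1\<close>
    forces this sign.\<close>
  have c_pos: "c u > 0" if "u \<in> U" for u
    using rel(2)[OF that] C(8)[OF that] w[of u]
    by (metis mult_pos_pos not_less_iff_gr_or_eq mult_pos_neg mult_neg_pos mult_zero_right mult_zero_left zero_less_one)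
  have k_const: "k (x, y) = k (x0, y)" if "x \<in> ?A" "y \<in> ?B" for x y
    using p_minimal_partial_y(1)[OF min cc _ _ _ AB x0 that] by (simp add: k_def \<phi>y_def)
  have dc: "((\<lambda>t. c (t, y)) has_real_derivative 2 * alpha \<Sigma> e (\<phi> (x, y)) * c (x, y)) (at x)"
    if "x \<in> ?A" "y \<in> ?B" for x y
    using p_minimal_partial_y(2)[OF min cc _ _ _ AB x0 that] by (simp add: c_def \<phi>y_def)
  define d where "d = (\<lambda>y. c (x0, y) / q (x0, y))"
  have cq: "c (x, y) = d y * q (x, y)" if "x \<in> ?A" "y \<in> ?B" for x y
  proof -
    have "c (x, y) / q (x, y) = c (x0, y) / q (x0, y)"
    proof (rule vector_derivative_zero_const[where f = "\<lambda>t. c (t, y) / q (t, y)" and S = ?A])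
      fix t assume t: "t \<in> ?A"
      then have tU: "(t, y) \<in> U"
        using AB that by blast
      have "((\<lambda>t. c (t, y) / q (t, y)) has_real_derivative 0) (at t)"
        using DERIV_divide[OF dc[OF t that(2)] q(3)[OF tU] q(2)[OF tU]] by (simp add: mult_ac)
      then show "((\<lambda>t. c (t, y) / q (t, y)) has_vector_derivative 0) (at t)"
        by (simp add: has_real_derivative_iff_has_vector_derivative)
    qed (use that x0 in auto)
    moreover have "(x, y) \<in> U"
      using AB that by blast
    ultimately show ?thesis
      using q(2)[of "(x, y)"] by (simp add: d_def divide_eq_eq)
  qed
  have sm: "smooth_on U \<phi>x" "smooth_on U \<phi>y"
    unfolding \<phi>x_def \<phi>y_def by (rule smooth_on_frechet_derivative[OF C(4)])+
  have sm_fst: "smooth_on U (\<lambda>u. fst (g u))" if "smooth_on U g" for g :: "real \<times> real \<Rightarrow> heis"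
    using smooth_on_bounded_linear[OF bounded_linear_fst C(3) that] .
  have sm_fst_snd: "smooth_on U (\<lambda>u. fst (snd (g u)))" if "smooth_on U g" for g :: "real \<times> real \<Rightarrow> heis"
    using smooth_on_bounded_linear[OF bounded_linear_fst_comp[OF bounded_linear_snd] C(3) that] .
  have sm_snd_snd: "smooth_on U (\<lambda>u. snd (snd (g u)))" if "smooth_on U g" for g :: "real \<times> real \<Rightarrow> heis"
    using smooth_on_bounded_linear[OF bounded_linear_snd_comp[OF bounded_linear_snd] C(3) that] .
  have smc: "smooth_on U c"
    unfolding c_def contact_form_expand
    by (intro smooth_on_add smooth_on_diff smooth_on_mult C(3) sm_fst sm_fst_snd sm_snd_snd sm C(4))
  \<comment> \<open>Replacing \<open>e \<circ> \<phi>\<close> by the smooth partial derivative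
    \<open>\<phi>x\<close> turns \<open>k\<close> into a polynomial in smooth functions.\<close>
  have "smooth_on U (\<lambda>u. fst (\<phi>y u) * fst (\<phi>x u) + fst (snd (\<phi>y u)) * fst (snd (\<phi>x u)))"
    by (intro smooth_on_add smooth_on_mult C(3) sm_fst sm_fst_snd sm)
  then have smk: "smooth_on U k"
    by (rule smooth_on_cong[OF C(3), rotated])
      (use characteristic_field_regular(3)[OF C(1,2)] C(5) in \<open>auto simp: k_def \<phi>x_def adapted_metric_contact\<close>)
  have sm_slice: "smooth_on ?B (\<lambda>y. g (x0, y))" if "smooth_on U g" for g :: "real \<times> real \<Rightarrow> real"
    by (rule smooth_on_compose[OF _ that smooth_on_Pair[OF _ smooth_on_const smooth_on_linear[OF bounded_linear_ident]]])
      (use AB x0 in auto)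
  have x0U: "(x0, y) \<in> U" if "y \<in> ?B" for y
    using AB x0 that by blast
  have smd: "smooth_on ?B d"
    unfolding d_def by (intro smooth_on_divide sm_slice smc q(1) q(2)[OF x0U]) auto
  have d0: "d y \<noteq> 0" if "y \<in> ?B" for y
    using c_pos[OF x0U[OF that]] q(2)[OF x0U[OF that]] by (simp add: d_def)
  have sgn_d: "sgn (d y) = sgn (d y0)" if "y \<in> ?B" for y
    by (rule connected_nonzero_sgn_const[OF _ smooth_on_continuous_on[OF smd] d0 that y0]) auto
  \<comment> \<open>With the constant factor \<open>sgn (d y0)\<close> smoothness is evident, while
    the constancy of the sign makes \<open>d1\<close> the absolute value of \<open>d\<close> on the
    interval.\<close>
  define d1 where "d1 = (\<lambda>y. sgn (d y0) * d y)"
  have d1: "d1 y = \<bar>d y\<bar>" if "y \<in> ?B" for y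
    unfolding d1_def sgn_d[OF that, symmetric] by (simp add: abs_sgn mult.commute)
  have smd1: "smooth_on ?B d1"
    unfolding d1_def by (intro smooth_on_mult smooth_on_const smd) auto
  have lt: "y0 - \<epsilon> < y0 + \<epsilon>"
    using \<epsilon> by simp
  have d1_pos: "d1 y > 0" if "y \<in> ?B" for y
    using d1[OF that] d0[OF that] by simp
  obtain \<Psi> h N where N: "open N" and \<Psi>: "continuous_on ?B \<Psi>" and h: "smooth_on N h"
    and \<Psi>h: "\<And>y. y \<in> ?B \<Longrightarrow> \<Psi> y \<in> N \<and> h (\<Psi> y) = y"
      "\<And>z. z \<in> N \<Longrightarrow> h z \<in> ?B \<and> \<Psi> (h z) = z"
    and dh: "\<And>z. z \<in> N \<Longrightarrow> (h has_real_derivative 1 / d1 (h z)) (at z)"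
    by (rule smooth_increasing_coordinate[OF smd1 lt d1_pos]) (assumption, rule that)
  obtain \<Gamma> where \<Gamma>: "smooth_on ?B \<Gamma>" "\<And>y. y \<in> ?B \<Longrightarrow> (\<Gamma> has_real_derivative k (x0, y)) (at y)"
    by (rule smooth_antiderivative_exists[OF sm_slice[OF smk] lt]) (rule that)
  have hB: "h z \<in> ?B" if "z \<in> N" for z
    using \<Psi>h(2)[OF that] by blast
  define f where "f = (\<lambda>z. \<Gamma> (h z))"
  have f: "smooth_on N f"
    unfolding f_def by (rule smooth_on_compose[OF N \<Gamma>(1) h]) (use hB in blast)
  have df: "(f has_real_derivative k (x0, h z) * (1 / d1 (h z))) (at z)" if "z \<in> N" for z
    unfolding f_def by (rule DERIV_chain2[OF \<Gamma>(2)[OF hB[OF that]] dh[OF that]])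
  have dh_pos: "1 / d1 (h z) > 0" if "z \<in> N" for z
    using d1_pos[OF hB[OF that]] by simp
  define G where "G = (\<lambda>u. (s * fst u - f (snd u), h (snd u)))"
  define U' where "U' = {u. snd u \<in> N \<and> s * fst u - f (snd u) \<in> ?A}"
  define a' where "a' = (\<lambda>u. s * (a (G u) + b (G u) * (k (x0, h (snd u)) * (1 / d1 (h (snd u))))
      / (1 / d1 (h (snd u)))))"
  define b' where "b' = (\<lambda>u. b (G u) / (1 / d1 (h (snd u))))"
  have GU': "G ` U' = ?A \<times> ?B"
    and cc': "compatible_coords \<Sigma> e1 U' (\<phi> \<circ> G) a' b'"
    and \<alpha>': "\<And>u. u \<in> U' \<Longrightarrow> alpha \<Sigma> e1 (\<phi> (G u)) = s * alpha \<Sigma> e (\<phi> (G u))"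
    using compatible_coords_reparam[OF cc _ _ AB W(1) \<phi>W ss e1 N h dh dh_pos \<Psi> \<Psi>h f df]
    unfolding G_def U'_def a'_def b'_def by simp_all
  have GQ: "G u \<in> ?A \<times> ?B" if "u \<in> U'" for u
    using GU' that by blast
  have G: "fst (G u) \<in> ?A" "G u \<in> U" "snd u \<in> N" "G u = (fst (G u), h (snd u))" if "u \<in> U'" for u
    using that GQ[OF that] subsetD[OF AB GQ[OF that]] by (simp_all add: U'_def G_def)
  have a'0: "a' u = 0" if "u \<in> U'" for u
  proof -
    \<comment> \<open>The shift \<open>f\<close> depends on \<open>y\<close> only, so it can cancel
      \<open>a\<close> at every \<open>x\<close> precisely because \<open>k\<close> is constant
      along the ruling. What remains is \<open>a + b k = 0\<close>.\<close>
    have "k (x0, h (snd u)) = k (G u)"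
      using k_const[OF G(1)[OF that] hB[OF G(3)[OF that]]] G(4)[OF that] by metis
    then show ?thesis
      using rel(1)[OF G(2)[OF that]] d1_pos[OF hB[OF G(3)[OF that]]] by (simp add: a'_def)
  qed
  have b': "b' u = 1 / \<bar>q (G u)\<bar> / sqrt (1 + (alpha \<Sigma> e1 (\<phi> (G u)))\<^sup>2)" if "u \<in> U'" for u
  proof -
    have "c (G u) = d (h (snd u)) * q (G u)"
      using cq[OF G(1)[OF that] hB[OF G(3)[OF that]]] G(4)[OF that] by metis
    then have "c (G u) = d1 (h (snd u)) * \<bar>q (G u)\<bar>"
      using c_pos[OF G(2)[OF that]] d1[OF hB[OF G(3)[OF that]]] by (metis abs_mult abs_of_pos)
    \<comment> \<open>The new coefficient is \<open>b d1\<close>, and \<open>c = d1 |q|\<close> in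
      \<open>b c w = 1\<close> moves \<open>d1\<close> from \<open>c\<close> to
      \<open>b\<close>.\<close>
    then have "b' u * (\<bar>q (G u)\<bar> * w (G u)) = 1"
      using rel(2)[OF G(2)[OF that]] by (simp add: b'_def mult_ac)
    moreover have "\<bar>q (G u)\<bar> * w (G u) > 0"
      using q(2)[OF G(2)[OF that]] w by simp
    ultimately have "b' u = 1 / (\<bar>q (G u)\<bar> * w (G u))"
      by (metis less_irrefl nonzero_eq_divide_eq)
    moreover have "w (G u) = sqrt (1 + (alpha \<Sigma> e1 (\<phi> (G u)))\<^sup>2)"
      using ss by (simp add: w_def \<alpha>'[OF that] power_mult_distrib power2_eq_square[of s])
    ultimately show ?thesis
      by (simp add: divide_divide_eq_left)
  qed
  have eq: "(\<lambda>(x, y). \<phi> (s * x - f y, h y)) = \<phi> \<circ> G"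
    by (auto simp: G_def)
  have im: "(\<phi> \<circ> G) ` U' = \<phi> ` (?A \<times> ?B)"
    unfolding image_comp[symmetric] GU' ..
  show ?thesis
  proof (rule that[OF s, of U' f h b'])
    show "open (snd ` U')"
      using open_image_snd[OF compatible_coordsD(3)[OF cc']] .
    have "snd ` U' \<subseteq> N"
      using G(3) by blast
    then show "smooth_on (snd ` U') f" "smooth_on (snd ` U') h"
      using smooth_on_subset f h by blast+
    show "(s * x - f y, h y) \<in> U" if "(x, y) \<in> U'" for x y
      using G(2)[OF that] by (simp add: G_def)
    show "\<phi> (x0, y0) \<in> (\<lambda>(x, y). \<phi> (s * x - f y, h y)) ` U'"
      unfolding eq im using x0 y0 by blast
    show "(\<lambda>(x, y). \<phi> (s * x - f y, h y)) ` U' \<subseteq> W"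
      unfolding eq im by (rule \<phi>W)
    show "orthogonal_coords \<Sigma> e1 U' (\<lambda>(x, y). \<phi> (s * x - f y, h y)) (\<lambda>_. 0) b'"
      unfolding eq orthogonal_coords_def using cc' a'0 by (simp add: compatible_coords_def)
    show "alpha \<Sigma> e1 (\<phi> (s * x - f y, h y)) = s * alpha \<Sigma> e (\<phi> (s * x - f y, h y))"
      if "(x, y) \<in> U'" for x y
      using \<alpha>'[OF that] by (simp add: G_def)
    show "b' (x, y) = 1 / \<bar>q (s * x - f y, h y)\<bar> / sqrt (1 + (alpha \<Sigma> e1 (\<phi> (s * x - f y, h y)))\<^sup>2)"
      if "(x, y) \<in> U'" for x y
      using b'[OF that] by (simp add: G_def)
  qed
qed

section \<open>Existence of normal coordinates\<close>

lemma smooth_on_compose_snd: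
  fixes c :: "real \<Rightarrow> real"
  assumes "open U" "smooth_on (snd ` U) c"
  shows "smooth_on U (\<lambda>u::real \<times> real. c (snd u))"
  by (rule smooth_on_compose[OF assms smooth_on_linear[OF bounded_linear_snd]]) simp

lemma normal_coords_I_exist:
  assumes min: "p_minimal \<Sigma>" and I: "special_type_I \<Sigma>"
    and W: "characteristic_field \<Sigma> W e1" "p \<in> W"
  shows "\<exists>U \<phi> a b \<zeta>1. p \<in> \<phi> ` U \<and> \<phi> ` U \<subseteq> W \<and> normal_coords_I \<Sigma> e1 U \<phi> a b \<zeta>1"
proof -
  have "p \<in> \<Sigma>"
    using W openin_imp_subset unfolding characteristic_field_def by blast
  then obtain e U \<phi> a b c1 where cc: "compatible_coords \<Sigma> e U \<phi> a b" and p: "p \<in> \<phi> ` U"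
    and c1: "type_I_form U (alpha \<Sigma> e \<circ> \<phi>) c1"
    using I unfolding special_type_I_def by blast
  note C = compatible_coordsD[OF cc]
  obtain x0 y0 where xy: "(x0, y0) \<in> U" "p = \<phi> (x0, y0)"
    using p by auto
  have sc: "smooth_on (snd ` U) c1"
    using c1 by (simp add: type_I_form_def)
  have form: "x + c1 y \<noteq> 0" "alpha \<Sigma> e (\<phi> (x, y)) = 1 / (x + c1 y)" if "(x, y) \<in> U" for x y
    using c1 that by (auto simp: type_I_form_def)
  define q where "q = (\<lambda>u. (fst u + c1 (snd u)) * (fst u + c1 (snd u)))"
  have q: "smooth_on U q"
    unfolding q_def by (intro smooth_on_mult smooth_on_add C(3) smooth_on_const
      smooth_on_linear[OF bounded_linear_fst] smooth_on_compose_snd sc)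
  have dq: "((\<lambda>t. q (t, y)) has_real_derivative 2 * alpha \<Sigma> e (\<phi> (x, y)) * q (x, y)) (at x)"
    if "(x, y) \<in> U" for x y
    unfolding q_def using form[OF that] by (auto intro!: derivative_eq_intros)
  have q0: "q u \<noteq> 0" if "u \<in> U" for u
    using form(1)[of "fst u" "snd u"] that by (simp add: q_def)
  obtain s f h U' b' where s: "s = 1 \<or> s = - 1"
    and sm: "open (snd ` U')" "smooth_on (snd ` U') f" "smooth_on (snd ` U') h"
    and U': "\<And>x y. (x, y) \<in> U' \<Longrightarrow> (s * x - f y, h y) \<in> U"
    and im: "\<phi> (x0, y0) \<in> (\<lambda>(x, y). \<phi> (s * x - f y, h y)) ` U'"
      "(\<lambda>(x, y). \<phi> (s * x - f y, h y)) ` U' \<subseteq> W"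
    and oc: "orthogonal_coords \<Sigma> e1 U' (\<lambda>(x, y). \<phi> (s * x - f y, h y)) (\<lambda>_. 0) b'"
    and \<alpha>: "\<And>x y. (x, y) \<in> U' \<Longrightarrow>
       alpha \<Sigma> e1 (\<phi> (s * x - f y, h y)) = s * alpha \<Sigma> e (\<phi> (s * x - f y, h y))"
    and b': "\<And>x y. (x, y) \<in> U' \<Longrightarrow> b' (x, y) = 1 / \<bar>q (s * x - f y, h y)\<bar>
       / sqrt (1 + (alpha \<Sigma> e1 (\<phi> (s * x - f y, h y)))\<^sup>2)"
    by (rule normalized_coords[OF min cc xy(1) W(1) _ q q0 dq]) (use W(2) xy(2) in simp, assumption+, rule that)
  \<comment> \<open>Chosen so that the old denominator at the new point is
    \<open>s * (x + \<zeta> y)\<close>; this sign cancels the one in the transformation of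
    \<alpha>.\<close>
  define \<zeta> where "\<zeta> = (\<lambda>y. s * (c1 (h y) - f y))"
  have h: "smooth_on (snd ` U') (\<lambda>y. c1 (h y))"
    by (rule smooth_on_compose[OF sm(1) sc sm(3)]) (use U' in force)
  have "smooth_on (snd ` U') \<zeta>"
    unfolding \<zeta>_def
    by (intro smooth_on_mult smooth_on_const smooth_on_diff h sm)
  moreover have eq: "s * x - f y + c1 (h y) = s * (x + \<zeta> y)" for x y
    using s by (auto simp: \<zeta>_def)
  moreover have "x + \<zeta> y \<noteq> 0" "alpha \<Sigma> e1 (\<phi> (s * x - f y, h y)) = 1 / (x + \<zeta> y)"
    if "(x, y) \<in> U'" for x y
    using form[OF U'[OF that]] \<alpha>[OF that] s unfolding eq by auto
  moreover from this have "b' (x, y) = (alpha \<Sigma> e1 (\<phi> (s * x - f y, h y)))\<^sup>2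
      / sqrt (1 + (alpha \<Sigma> e1 (\<phi> (s * x - f y, h y)))\<^sup>2)" if "(x, y) \<in> U'" for x y
    unfolding b'[OF that] q_def fst_conv snd_conv eq using s that
    by (auto simp: power2_eq_square)
  ultimately have "normal_coords_I \<Sigma> e1 U' (\<lambda>(x, y). \<phi> (s * x - f y, h y)) (\<lambda>_. 0) b' \<zeta>"
    using oc unfolding normal_coords_I_def type_I_form_def Let_def by auto
  then show ?thesis
    using im xy(2) by blast
qed

lemma normal_coords_II_exist:
  assumes min: "p_minimal \<Sigma>" and II: "special_type_II \<Sigma>"
    and W: "characteristic_field \<Sigma> W e1" "p \<in> W"
  shows "\<exists>U \<phi> a b \<zeta>1. p \<in> \<phi> ` U \<and> \<phi> ` U \<subseteq> W \<and> normal_coords_II \<Sigma> e1 U \<phi> a b \<zeta>1"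
proof -
  have "p \<in> \<Sigma>"
    using W openin_imp_subset unfolding characteristic_field_def by blast
  then obtain e U \<phi> a b c1 where cc: "compatible_coords \<Sigma> e U \<phi> a b" and p: "p \<in> \<phi> ` U"
    and c1: "type_II_form U (alpha \<Sigma> e \<circ> \<phi>) c1"
    using II unfolding special_type_II_def by blast
  note C = compatible_coordsD[OF cc]
  obtain x0 y0 where xy: "(x0, y0) \<in> U" "p = \<phi> (x0, y0)"
    using p by auto
  have sc: "smooth_on (snd ` U) c1"
    using c1 by (simp add: type_II_form_def)
  have form: "2 * x + c1 y \<noteq> 0" "alpha \<Sigma> e (\<phi> (x, y)) = 1 / (2 * x + c1 y)" if "(x, y) \<in> U" for x y
    using c1 that by (auto simp: type_II_form_def)
  define q where "q = (\<lambda>u. 2 * fst u + c1 (snd u))"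
  have q: "smooth_on U q"
    unfolding q_def by (intro smooth_on_mult smooth_on_add C(3) smooth_on_const
      smooth_on_linear[OF bounded_linear_fst] smooth_on_compose_snd sc)
  have dq: "((\<lambda>t. q (t, y)) has_real_derivative 2 * alpha \<Sigma> e (\<phi> (x, y)) * q (x, y)) (at x)"
    if "(x, y) \<in> U" for x y
    unfolding q_def using form[OF that] by (auto intro!: derivative_eq_intros simp: nonzero_divide_eq_eq)
  have q0: "q u \<noteq> 0" if "u \<in> U" for u
    using form(1)[of "fst u" "snd u"] that by (simp add: q_def)
  obtain s f h U' b' where s: "s = 1 \<or> s = - 1"
    and sm: "open (snd ` U')" "smooth_on (snd ` U') f" "smooth_on (snd ` U') h"
    and U': "\<And>x y. (x, y) \<in> U' \<Longrightarrow> (s * x - f y, h y) \<in> U"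
    and im: "\<phi> (x0, y0) \<in> (\<lambda>(x, y). \<phi> (s * x - f y, h y)) ` U'"
      "(\<lambda>(x, y). \<phi> (s * x - f y, h y)) ` U' \<subseteq> W"
    and oc: "orthogonal_coords \<Sigma> e1 U' (\<lambda>(x, y). \<phi> (s * x - f y, h y)) (\<lambda>_. 0) b'"
    and \<alpha>: "\<And>x y. (x, y) \<in> U' \<Longrightarrow>
       alpha \<Sigma> e1 (\<phi> (s * x - f y, h y)) = s * alpha \<Sigma> e (\<phi> (s * x - f y, h y))"
    and b': "\<And>x y. (x, y) \<in> U' \<Longrightarrow> b' (x, y) = 1 / \<bar>q (s * x - f y, h y)\<bar>
       / sqrt (1 + (alpha \<Sigma> e1 (\<phi> (s * x - f y, h y)))\<^sup>2)"
    by (rule normalized_coords[OF min cc xy(1) W(1) _ q q0 dq]) (use W(2) xy(2) in simp, assumption+, rule that)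
  \<comment> \<open>Here the shift by \<open>f\<close> enters through \<open>2 * x\<close>, hence
    twice.\<close>
  define \<zeta> where "\<zeta> = (\<lambda>y. s * (c1 (h y) - 2 * f y))"
  have h: "smooth_on (snd ` U') (\<lambda>y. c1 (h y))"
    by (rule smooth_on_compose[OF sm(1) sc sm(3)]) (use U' in force)
  have "smooth_on (snd ` U') \<zeta>"
    unfolding \<zeta>_def
    by (intro smooth_on_mult smooth_on_const smooth_on_diff h sm)
  moreover have eq: "2 * (s * x - f y) + c1 (h y) = s * (2 * x + \<zeta> y)" for x y
    using s by (auto simp: \<zeta>_def)
  moreover have "2 * x + \<zeta> y \<noteq> 0" "alpha \<Sigma> e1 (\<phi> (s * x - f y, h y)) = 1 / (2 * x + \<zeta> y)"
    if "(x, y) \<in> U'" for x y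
    using form[OF U'[OF that]] \<alpha>[OF that] s unfolding eq by auto
  moreover from this have "b' (x, y) = \<bar>alpha \<Sigma> e1 (\<phi> (s * x - f y, h y))\<bar>
      / sqrt (1 + (alpha \<Sigma> e1 (\<phi> (s * x - f y, h y)))\<^sup>2)" if "(x, y) \<in> U'" for x y
    unfolding b'[OF that] q_def fst_conv snd_conv eq using s that
    by (auto simp: abs_mult)
  ultimately have "normal_coords_II \<Sigma> e1 U' (\<lambda>(x, y). \<phi> (s * x - f y, h y)) (\<lambda>_. 0) b' \<zeta>"
    using oc unfolding normal_coords_II_def type_II_form_def Let_def by auto
  then show ?thesis
    using im xy(2) by blast
qed

lemma normal_coords_general_exist:
  assumes min: "p_minimal \<Sigma>" and gen: "general_type \<Sigma>"
    and W: "characteristic_field \<Sigma> W e1" "p \<in> W"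
  shows "\<exists>U \<phi> a b \<zeta>1 \<zeta>2. p \<in> \<phi> ` U \<and> \<phi> ` U \<subseteq> W \<and> normal_coords_general \<Sigma> e1 U \<phi> a b \<zeta>1 \<zeta>2"
proof -
  have "p \<in> \<Sigma>"
    using W openin_imp_subset unfolding characteristic_field_def by blast
  then obtain e U \<phi> a b c1 c2 where cc: "compatible_coords \<Sigma> e U \<phi> a b" and p: "p \<in> \<phi> ` U"
    and c1: "general_type_form U (alpha \<Sigma> e \<circ> \<phi>) c1 c2"
    using gen unfolding general_type_def by blast
  note C = compatible_coordsD[OF cc]
  obtain x0 y0 where xy: "(x0, y0) \<in> U" "p = \<phi> (x0, y0)"
    using p by auto
  have sc: "smooth_on (snd ` U) c1" "smooth_on (snd ` U) c2"
    using c1 by (simp_all add: general_type_form_def)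
  have form: "c2 y \<noteq> 0" "(x + c1 y)\<^sup>2 + c2 y \<noteq> 0"
    "alpha \<Sigma> e (\<phi> (x, y)) = (x + c1 y) / ((x + c1 y)\<^sup>2 + c2 y)" if "(x, y) \<in> U" for x y
    using c1 that by (auto simp: general_type_form_def)
  define q where "q = (\<lambda>u. (fst u + c1 (snd u)) * (fst u + c1 (snd u)) + c2 (snd u))"
  have q: "smooth_on U q"
    unfolding q_def by (intro smooth_on_mult smooth_on_add C(3) smooth_on_const
      smooth_on_linear[OF bounded_linear_fst] smooth_on_compose_snd sc)
  have dq: "((\<lambda>t. q (t, y)) has_real_derivative 2 * alpha \<Sigma> e (\<phi> (x, y)) * q (x, y)) (at x)"
    if "(x, y) \<in> U" for x y
    unfolding q_def using form(2,3)[OF that]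
    by (auto intro!: derivative_eq_intros simp: power2_eq_square)
  have q0: "q u \<noteq> 0" if "u \<in> U" for u
    using form(2)[of "fst u" "snd u"] that by (simp add: q_def power2_eq_square)
  obtain s f h U' b' where s: "s = 1 \<or> s = - 1"
    and sm: "open (snd ` U')" "smooth_on (snd ` U') f" "smooth_on (snd ` U') h"
    and U': "\<And>x y. (x, y) \<in> U' \<Longrightarrow> (s * x - f y, h y) \<in> U"
    and im: "\<phi> (x0, y0) \<in> (\<lambda>(x, y). \<phi> (s * x - f y, h y)) ` U'"
      "(\<lambda>(x, y). \<phi> (s * x - f y, h y)) ` U' \<subseteq> W"
    and oc: "orthogonal_coords \<Sigma> e1 U' (\<lambda>(x, y). \<phi> (s * x - f y, h y)) (\<lambda>_. 0) b'"
    and \<alpha>: "\<And>x y. (x, y) \<in> U' \<Longrightarrow>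
       alpha \<Sigma> e1 (\<phi> (s * x - f y, h y)) = s * alpha \<Sigma> e (\<phi> (s * x - f y, h y))"
    and b': "\<And>x y. (x, y) \<in> U' \<Longrightarrow> b' (x, y) = 1 / \<bar>q (s * x - f y, h y)\<bar>
       / sqrt (1 + (alpha \<Sigma> e1 (\<phi> (s * x - f y, h y)))\<^sup>2)"
    by (rule normalized_coords[OF min cc xy(1) W(1) _ q q0 dq]) (use W(2) xy(2) in simp, assumption+, rule that)
  define \<zeta> where "\<zeta> = (\<lambda>y. s * (c1 (h y) - f y))"
  have h: "smooth_on (snd ` U') (\<lambda>y. c1 (h y))" "smooth_on (snd ` U') (\<lambda>y. c2 (h y))"
    by (rule smooth_on_compose[OF sm(1) sc(1) sm(3)] smooth_on_compose[OF sm(1) sc(2) sm(3)],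
      use U' in force)+
  have "smooth_on (snd ` U') \<zeta>"
    unfolding \<zeta>_def
    by (intro smooth_on_mult smooth_on_const smooth_on_diff h(1) sm)
  \<comment> \<open>In the general form the numerator is odd and the denominator even in
    \<open>x + \<zeta> y\<close>: the sign of the numerator cancels that of \<alpha>, and the second
    parameter is merely composed with \<open>h\<close>.\<close>
  moreover have ss: "s * (s * t) = t" "(s * t)\<^sup>2 = t\<^sup>2" for t
    using s by auto
  moreover have eq: "s * x - f y + c1 (h y) = s * (x + \<zeta> y)" for x y
    using s by (auto simp: \<zeta>_def)
  moreover have "c2 (h y) \<noteq> 0" "(x + \<zeta> y)\<^sup>2 + c2 (h y) \<noteq> 0"
    "alpha \<Sigma> e1 (\<phi> (s * x - f y, h y)) = (x + \<zeta> y) / ((x + \<zeta> y)\<^sup>2 + c2 (h y))"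
    if "(x, y) \<in> U'" for x y
    using form[OF U'[OF that]] \<alpha>[OF that] unfolding eq ss(2)
    by (auto simp: ss(1) times_divide_eq_right[symmetric] simp del: times_divide_eq_right)
  \<comment> \<open>Both branches are \<open>1 / |q|\<close>: where the numerator of \<alpha> is
    nonzero, dividing by its absolute value leaves the reciprocal of the denominator.\<close>
  moreover from this have "b' (x, y) = (if x + \<zeta> y = 0 then 1 / \<bar>(x + \<zeta> y)\<^sup>2 + c2 (h y)\<bar>
      else \<bar>alpha \<Sigma> e1 (\<phi> (s * x - f y, h y))\<bar> / \<bar>x + \<zeta> y\<bar>)
      / sqrt (1 + (alpha \<Sigma> e1 (\<phi> (s * x - f y, h y)))\<^sup>2)" if "(x, y) \<in> U'" for x y
    unfolding b'[OF that] q_def fst_conv snd_conv eq power2_eq_square[symmetric] ss(2) using that by auto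
  ultimately have "normal_coords_general \<Sigma> e1 U' (\<lambda>(x, y). \<phi> (s * x - f y, h y)) (\<lambda>_. 0) b' \<zeta> (\<lambda>y. c2 (h y))"
    using oc h(2) unfolding normal_coords_general_def general_type_form_def Let_def by auto
  then show ?thesis
    using im xy(2) by blast
qed


section \<open>Uniqueness of normal coordinates\<close>

text \<open>\<open>F = \<psi>' \<circ> \<phi>\<close> is a continuous lift of \<open>\<phi>\<close>
  through the immersion \<open>\<phi>'\<close>, hence differentiable. Both charts express the same
  frame of the surface at the same point, by \<open>\<partial>\<^sub>x\<close> and, as the first
  coefficients vanish, by a multiple of \<open>\<partial>\<^sub>y\<close>. Comparing the multiples
  gives the diagonal derivative.\<close>

lemma orthogonal_transition:
  assumes oc: "orthogonal_coords \<Sigma> e U \<phi> a b" and oc': "orthogonal_coords \<Sigma> e U' \<phi>' a' b'"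
    and im: "\<phi> ` U = \<phi>' ` U'" and conn: "connected (\<phi> ` U)"
  obtains F where "open U" "connected U" "F ` U = U'" "\<And>u. u \<in> U \<Longrightarrow> \<phi>' (F u) = \<phi> u"
    "\<And>u. u \<in> U \<Longrightarrow> (F has_derivative (\<lambda>v. (fst v, b' (F u) / b u * snd v))) (at u)"
    "\<And>u. u \<in> U \<Longrightarrow> b u > 0"
proof -
  have cc: "compatible_coords \<Sigma> e U \<phi> a b" "compatible_coords \<Sigma> e U' \<phi>' a' b'"
    and a0: "\<And>u. u \<in> U \<Longrightarrow> a u = 0" "\<And>u. u \<in> U' \<Longrightarrow> a' u = 0"
    using oc oc' by (simp_all add: orthogonal_coords_def)
  note C = compatible_coordsD[OF cc(1)] and C' = compatible_coordsD[OF cc(2)]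
  obtain \<psi> where \<psi>: "homeomorphism U (\<phi> ` U) \<phi> \<psi>"
    using C(1) by (auto simp: surface_patch_def)
  obtain \<psi>' where \<psi>': "homeomorphism U' (\<phi>' ` U') \<phi>' \<psi>'"
    using C'(1) by (auto simp: surface_patch_def)
  define F where "F = (\<lambda>u. \<psi>' (\<phi> u))"
  have connU: "connected U"
    using connected_continuous_image[OF homeomorphism_cont2[OF \<psi>] conn] homeomorphism_image2[OF \<psi>]
    by simp
  have FU: "F ` U = U'"
    unfolding F_def using homeomorphism_image2[OF \<psi>'] im by (simp add: image_image[symmetric])
  have F: "F u \<in> U'" "\<phi>' (F u) = \<phi> u" if "u \<in> U" for u
  proof -
    show "F u \<in> U'"
      using FU that by blast
    have "\<phi> u \<in> \<phi>' ` U'"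
      using im that by blast
    then show "\<phi>' (F u) = \<phi> u"
      unfolding F_def by (rule homeomorphism_apply2[OF \<psi>'])
  qed
  have "continuous_on U F"
    unfolding F_def
    by (rule continuous_on_compose2[OF homeomorphism_cont2[OF \<psi>'] smooth_on_continuous_on[OF C(4)]])
      (simp add: im)
  then have contF: "isCont F u" if "u \<in> U" for u
    using that by (simp add: continuous_on_eq_continuous_at[OF C(3)])
  have "(F has_derivative (\<lambda>v. (fst v, b' (F u) / b u * snd v))) (at u)" if u: "u \<in> U" for u
  proof -
    obtain K where K: "bounded_linear K" "\<And>w. K (frechet_derivative \<phi>' (at (F u)) w) = w"
      using surface_patch_left_inverse[OF C'(1) F(1)[OF u]] by blast
    have linK: "linear K"
      using K(1) by (rule bounded_linear.linear)
    have lin: "linear (frechet_derivative \<phi> (at u))"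
      using has_derivative_linear[OF C(6)[OF u]] .
    have "((\<lambda>v. F v) has_derivative (\<lambda>h. K (frechet_derivative \<phi> (at u) h))) (at u within U)"
      by (rule has_derivative_lift_immersion[OF has_derivative_at_withinI[OF C(6)[OF u]] u _
          C'(6)[OF F(1)[OF u]] K F(2)])
        (use contF[OF u] in \<open>auto intro: continuous_at_imp_continuous_at_within\<close>)
    then have D: "(F has_derivative (\<lambda>h. K (frechet_derivative \<phi> (at u) h))) (at u)"
      unfolding at_within_open[OF u C(3)] .
    have "frechet_derivative \<phi> (at u) (1, 0) = frechet_derivative \<phi>' (at (F u)) (1, 0)"
      using C(5)[OF u] C'(5)[OF F(1)[OF u]] F(2)[OF u] by simp
    then have Kx: "K (frechet_derivative \<phi> (at u) (1, 0)) = (1, 0)"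
      using K(2) by metis
    have "b u *\<^sub>R frechet_derivative \<phi> (at u) (0, 1) = b' (F u) *\<^sub>R frechet_derivative \<phi>' (at (F u)) (0, 1)"
      using C(7)[OF u] C'(7)[OF F(1)[OF u]] F(2)[OF u] a0(1)[OF u] a0(2)[OF F(1)[OF u]] by simp
    then have "b u *\<^sub>R K (frechet_derivative \<phi> (at u) (0, 1)) = b' (F u) *\<^sub>R (0, 1)"
      using K(2)[of "(0, 1)"] by (metis linear_scale[OF linK])
    then have "(1 / b u) *\<^sub>R b u *\<^sub>R K (frechet_derivative \<phi> (at u) (0, 1)) = (1 / b u) *\<^sub>R b' (F u) *\<^sub>R (0, 1)"
      by (rule arg_cong)
    then have Ky: "K (frechet_derivative \<phi> (at u) (0, 1)) = (0, b' (F u) / b u)"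
      using C(8)[OF u] by simp
    have "K (frechet_derivative \<phi> (at u) v) = (fst v, b' (F u) / b u * snd v)" for v
    proof -
      have v: "v = fst v *\<^sub>R (1, 0) + snd v *\<^sub>R (0, 1)"
        by (simp add: prod_eq_iff)
      have "K (frechet_derivative \<phi> (at u) (fst v *\<^sub>R (1, 0) + snd v *\<^sub>R (0, 1)))
          = fst v *\<^sub>R (1, 0) + snd v *\<^sub>R (0, b' (F u) / b u)"
        by (simp only: linear_add[OF lin] linear_scale[OF lin] linear_add[OF linK] linear_scale[OF linK] Kx Ky)
      then show ?thesis
        unfolding v[symmetric] by simp
    qed
    then show ?thesis
      using D by simp
  qed
  then show ?thesis
    using that[OF C(3) connU FU F(2)] C(8) by blast
qed

text \<open>Equality of the coefficients turns the derivative of \<open>F\<close> into the identity,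
  so \<open>F u - u\<close> is constant on the connected domain.\<close>

lemma transition_is_translation:
  fixes F :: "real \<times> real \<Rightarrow> real \<times> real"
  assumes "open U" "connected U"
    "\<And>u. u \<in> U \<Longrightarrow> (F has_derivative (\<lambda>v. (fst v, b' (F u) / b u * snd v))) (at u)"
    "\<And>u. u \<in> U \<Longrightarrow> b u > 0" "\<And>u. u \<in> U \<Longrightarrow> b' (F u) = b u"
  obtains m k where "\<And>x y. (x, y) \<in> U \<Longrightarrow> F (x, y) = (x + m, y + k)"
proof -
  have "((\<lambda>u. F u - u) has_derivative (\<lambda>v. 0)) (at u)" if "u \<in> U" for u
  proof -
    have id: "(\<lambda>v. (fst v, b' (F u) / b u * snd v)) = (\<lambda>v. v)"
      using assms(4,5)[OF that] by simp
    have "(F has_derivative (\<lambda>v. v)) (at u)"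
      using assms(3)[OF that] unfolding id .
    from has_derivative_diff[OF this has_derivative_ident] show ?thesis
      by simp
  qed
  then have "F u - u = F v - v" if "u \<in> U" "v \<in> U" for u v
    by (rule has_derivative_zero_unique_connected[OF assms(1,2) _ that])
  then obtain w where w: "\<And>u. u \<in> U \<Longrightarrow> F u - u = w"
    by metis
  have "F (x, y) = (x + fst w, y + snd w)" if "(x, y) \<in> U" for x y
    using w[OF that] by (simp add: prod_eq_iff diff_eq_eq add.commute)
  then show ?thesis
    using that by blast
qed

lemma translation_projection:
  assumes "F ` U = U'" "\<And>x y. (x, y) \<in> U \<Longrightarrow> F (x, y) = (x + m, y + (k::real))"
  shows "snd ` U' = (\<lambda>y. y + k) ` snd ` U"
proof -
  have "snd (F u) = snd u + k" if "u \<in> U" for u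
    using assms(2)[of "fst u" "snd u"] that by simp
  then show ?thesis
    unfolding assms(1)[symmetric] image_image by (intro image_cong) simp_all
qed

text \<open>\<alpha> belongs to the surface and \<open>e\<close>, not to the chart, and
  \<open>b\<close> is a function of it, so \<open>b'(F) = b\<close> holds at once.\<close>

lemma normal_coords_I_unique:
  assumes n: "normal_coords_I \<Sigma> e U \<phi> a b \<zeta>" and n': "normal_coords_I \<Sigma> e U' \<phi>' a' b' \<zeta>'"
    and im: "\<phi> ` U = \<phi>' ` U'" "connected (\<phi> ` U)"
  shows "\<exists>k m. snd ` U' = (\<lambda>y. y + k) ` snd ` U \<and> (\<forall>y\<in>snd ` U. \<zeta>' (y + k) = \<zeta> y + m)"
proof -
  have oc: "orthogonal_coords \<Sigma> e U \<phi> a b" "orthogonal_coords \<Sigma> e U' \<phi>' a' b'"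
    using n n' by (simp_all add: normal_coords_I_def)
  obtain F where F: "open U" "connected U" "F ` U = U'" "\<And>u. u \<in> U \<Longrightarrow> \<phi>' (F u) = \<phi> u"
    "\<And>u. u \<in> U \<Longrightarrow> (F has_derivative (\<lambda>v. (fst v, b' (F u) / b u * snd v))) (at u)"
    "\<And>u. u \<in> U \<Longrightarrow> b u > 0"
    using orthogonal_transition[OF oc im] by blast
  have FU: "F u \<in> U'" if "u \<in> U" for u
    using F(3) that by blast
  have "b' (F u) = b u" if "u \<in> U" for u
    using n n' that FU[OF that] by (auto simp: normal_coords_I_def Let_def F(4)[OF that])
  from transition_is_translation[OF F(1,2,5,6) this]
  obtain m k where mk: "\<And>x y. (x, y) \<in> U \<Longrightarrow> F (x, y) = (x + m, y + k)"
    by blast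
  have "\<zeta>' (y + k) = \<zeta> y + - m" if "(x, y) \<in> U" for x y
  proof -
    have "(x + m, y + k) \<in> U'" "\<phi>' (x + m, y + k) = \<phi> (x, y)"
      using FU[OF that] F(4)[OF that] mk[OF that] by simp_all
    then have "1 / (x + \<zeta> y) = 1 / (x + m + \<zeta>' (y + k))"
      using n n' that unfolding normal_coords_I_def type_I_form_def Let_def comp_def by fastforce
    then show ?thesis
      by simp
  qed
  then show ?thesis
    \<comment> \<open>A shift of \<open>x\<close> by \<open>m\<close> must be compensated in the
      parameter, hence the opposite sign.\<close>
    using translation_projection[OF F(3) mk] by (intro exI[of _ k] exI[of _ "- m"]) auto
qed

lemma normal_coords_II_unique:
  assumes n: "normal_coords_II \<Sigma> e U \<phi> a b \<zeta>" and n': "normal_coords_II \<Sigma> e U' \<phi>' a' b' \<zeta>'"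
    and im: "\<phi> ` U = \<phi>' ` U'" "connected (\<phi> ` U)"
  shows "\<exists>k m. snd ` U' = (\<lambda>y. y + k) ` snd ` U \<and> (\<forall>y\<in>snd ` U. \<zeta>' (y + k) = \<zeta> y + m)"
proof -
  have oc: "orthogonal_coords \<Sigma> e U \<phi> a b" "orthogonal_coords \<Sigma> e U' \<phi>' a' b'"
    using n n' by (simp_all add: normal_coords_II_def)
  obtain F where F: "open U" "connected U" "F ` U = U'" "\<And>u. u \<in> U \<Longrightarrow> \<phi>' (F u) = \<phi> u"
    "\<And>u. u \<in> U \<Longrightarrow> (F has_derivative (\<lambda>v. (fst v, b' (F u) / b u * snd v))) (at u)"
    "\<And>u. u \<in> U \<Longrightarrow> b u > 0"
    using orthogonal_transition[OF oc im] by blast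
  have FU: "F u \<in> U'" if "u \<in> U" for u
    using F(3) that by blast
  have "b' (F u) = b u" if "u \<in> U" for u
    using n n' that FU[OF that] by (auto simp: normal_coords_II_def Let_def F(4)[OF that])
  from transition_is_translation[OF F(1,2,5,6) this]
  obtain m k where mk: "\<And>x y. (x, y) \<in> U \<Longrightarrow> F (x, y) = (x + m, y + k)"
    by blast
  \<comment> \<open>The coordinate shift is doubled by the denominator
    \<open>2 * x + \<zeta> y\<close>.\<close>
  have "\<zeta>' (y + k) = \<zeta> y + - 2 * m" if "(x, y) \<in> U" for x y
  proof -
    have "(x + m, y + k) \<in> U'" "\<phi>' (x + m, y + k) = \<phi> (x, y)"
      using FU[OF that] F(4)[OF that] mk[OF that] by simp_all
    then have "1 / (2 * x + \<zeta> y) = 1 / (2 * (x + m) + \<zeta>' (y + k))"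
      using n n' that unfolding normal_coords_II_def type_II_form_def Let_def comp_def by fastforce
    then show ?thesis
      by simp
  qed
  then show ?thesis
    using translation_projection[OF F(3) mk] by (intro exI[of _ k] exI[of _ "- 2 * m"]) auto
qed

text \<open>Cross-multiplied, the equality says that
  \<open>(u + t) (v + t) (v - u) + c' (u + t) - c (v + t)\<close> vanishes. This is a polynomial of
  degree at most 2 in \<open>t\<close> with leading coefficient \<open>v - u\<close>, so three
  points determine it.\<close>

lemma general_form_rigid:
  fixes u v c c' \<delta> :: real
  assumes "\<delta> \<noteq> 0" and eq: "\<And>t. t \<in> {0, \<delta>, - \<delta>} \<Longrightarrow> (u + t)\<^sup>2 + c \<noteq> 0 \<and> (v + t)\<^sup>2 + c' \<noteq> 0 \<and>
      (u + t) / ((u + t)\<^sup>2 + c) = (v + t) / ((v + t)\<^sup>2 + c')"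
  shows "u = v" "c = c'"
proof -
  have cross: "(u + t) * ((v + t)\<^sup>2 + c') = (v + t) * ((u + t)\<^sup>2 + c)" if "t \<in> {0, \<delta>, - \<delta>}" for t
    using eq[OF that] frac_eq_eq by metis
  \<comment> \<open>The second difference over \<open>- \<delta>, 0, \<delta>\<close> isolates the
    quadratic coefficient.\<close>
  have "(v - u) * \<delta>\<^sup>2 * 2 = 0"
    using cross[of 0] cross[of \<delta>] cross[of "- \<delta>"] by simp algebra
  then show uv: "u = v"
    using assms(1) by simp
  \<comment> \<open>Two points are needed, as \<open>u\<close> may be zero; \<open>u\<close> and
    \<open>u + \<delta>\<close> cannot both be.\<close>
  have "u * (c' - c) = 0" "(u + \<delta>) * (c' - c) = 0"
    using cross[of 0] cross[of \<delta>] unfolding uv by simp_all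
  then show "c = c'"
    using assms(1) by auto
qed

text \<open>Without using the form of \<open>b\<close>, the diagonal derivative of \<open>F\<close>
  shows that it maps each short characteristic segment to one of constant second coordinate at unit
  speed. Comparing \<alpha> at three points of the segment matches the parameters, and only then
  does \<open>b'(F) = b\<close> follow.\<close>

lemma normal_coords_general_unique:
  assumes n: "normal_coords_general \<Sigma> e U \<phi> a b \<zeta> \<xi>"
    and n': "normal_coords_general \<Sigma> e U' \<phi>' a' b' \<zeta>' \<xi>'"
    and im: "\<phi> ` U = \<phi>' ` U'" "connected (\<phi> ` U)"
  shows "\<exists>k m. snd ` U' = (\<lambda>y. y + k) ` snd ` U \<and>
    (\<forall>y\<in>snd ` U. \<zeta>' (y + k) = \<zeta> y + m \<and> \<xi>' (y + k) = \<xi> y)"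
proof -
  have oc: "orthogonal_coords \<Sigma> e U \<phi> a b" "orthogonal_coords \<Sigma> e U' \<phi>' a' b'"
    using n n' by (simp_all add: normal_coords_general_def)
  obtain F where F: "open U" "connected U" "F ` U = U'" "\<And>u. u \<in> U \<Longrightarrow> \<phi>' (F u) = \<phi> u"
    "\<And>u. u \<in> U \<Longrightarrow> (F has_derivative (\<lambda>v. (fst v, b' (F u) / b u * snd v))) (at u)"
    "\<And>u. u \<in> U \<Longrightarrow> b u > 0"
    using orthogonal_transition[OF oc im] by blast
  have FU: "F u \<in> U'" if "u \<in> U" for u
    using F(3) that by blast
  have form: "(x + \<zeta> y)\<^sup>2 + \<xi> y \<noteq> 0"
    "alpha \<Sigma> e (\<phi> (x, y)) = (x + \<zeta> y) / ((x + \<zeta> y)\<^sup>2 + \<xi> y)"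
    "b (x, y) = (if x + \<zeta> y = 0 then 1 / \<bar>(x + \<zeta> y)\<^sup>2 + \<xi> y\<bar>
       else \<bar>alpha \<Sigma> e (\<phi> (x, y))\<bar> / \<bar>x + \<zeta> y\<bar>) / sqrt (1 + (alpha \<Sigma> e (\<phi> (x, y)))\<^sup>2)"
    if "(x, y) \<in> U" for x y
    using n that unfolding normal_coords_general_def general_type_form_def Let_def comp_def by blast+
  have form': "(x + \<zeta>' y)\<^sup>2 + \<xi>' y \<noteq> 0"
    "alpha \<Sigma> e (\<phi>' (x, y)) = (x + \<zeta>' y) / ((x + \<zeta>' y)\<^sup>2 + \<xi>' y)"
    "b' (x, y) = (if x + \<zeta>' y = 0 then 1 / \<bar>(x + \<zeta>' y)\<^sup>2 + \<xi>' y\<bar>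
       else \<bar>alpha \<Sigma> e (\<phi>' (x, y))\<bar> / \<bar>x + \<zeta>' y\<bar>) / sqrt (1 + (alpha \<Sigma> e (\<phi>' (x, y)))\<^sup>2)"
    if "(x, y) \<in> U'" for x y
    using n' that unfolding normal_coords_general_def general_type_form_def Let_def comp_def by blast+
  \<comment> \<open>The first row of the derivative does not involve the coefficients
    \<open>b\<close> and \<open>b'\<close>, so the shift in \<open>x\<close> is constant before
    these are compared.\<close>
  have "((\<lambda>u. fst (F u) - fst u) has_derivative (\<lambda>v. 0)) (at u)" if "u \<in> U" for u
    using has_derivative_diff[OF has_derivative_fst[OF F(5)[OF that]] has_derivative_fst[OF has_derivative_ident]]
    by simp
  then have "fst (F u) - fst u = fst (F v) - fst v" if "u \<in> U" "v \<in> U" for u v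
    by (rule has_derivative_zero_unique_connected[OF F(1,2) _ that])
  then obtain m where m: "\<And>u. u \<in> U \<Longrightarrow> fst (F u) - fst u = m"
    by metis
  have rigid: "x + \<zeta> y = fst (F (x, y)) + \<zeta>' (snd (F (x, y)))" "\<xi> y = \<xi>' (snd (F (x, y)))"
    if xy: "(x, y) \<in> U" for x y
  proof -
    obtain \<epsilon> where \<epsilon>: "\<epsilon> > 0" "{x - \<epsilon><..<x + \<epsilon>} \<times> {y - \<epsilon><..<y + \<epsilon>} \<subseteq> U"
      using open_contains_square[OF F(1) xy] by blast
    have U: "(t, y) \<in> U" if "t \<in> {x - \<epsilon><..<x + \<epsilon>}" for t
      using \<epsilon> that by (intro subsetD[OF \<epsilon>(2)]) auto
    have Y: "snd (F (t, y)) = snd (F (x, y))" if "t \<in> {x - \<epsilon><..<x + \<epsilon>}" for t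
    proof (rule vector_derivative_zero_const[where f = "\<lambda>t. snd (F (t, y))" and S = "{x - \<epsilon><..<x + \<epsilon>}"])
      fix r assume "r \<in> {x - \<epsilon><..<x + \<epsilon>}"
      from partial_x[OF has_derivative_snd[OF F(5)[OF U[OF this]]]]
      show "((\<lambda>t. snd (F (t, y))) has_vector_derivative 0) (at r)"
        by simp
    qed (use that \<epsilon>(1) in auto)
    have Ft: "F (x + t, y) = (x + m + t, snd (F (x, y)))" "(x + t, y) \<in> U" if "\<bar>t\<bar> < \<epsilon>" for t
    proof -
      have t: "x + t \<in> {x - \<epsilon><..<x + \<epsilon>}"
        using that by auto
      show "(x + t, y) \<in> U"
        using U[OF t] .
      show "F (x + t, y) = (x + m + t, snd (F (x, y)))"
        using m[OF U[OF t]] Y[OF t] by (simp add: prod_eq_iff)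
    qed
    define z where "z = snd (F (x, y))"
    have eq: "(x + \<zeta> y + t)\<^sup>2 + \<xi> y \<noteq> 0 \<and> (x + m + \<zeta>' z + t)\<^sup>2 + \<xi>' z \<noteq> 0 \<and>
        (x + \<zeta> y + t) / ((x + \<zeta> y + t)\<^sup>2 + \<xi> y) = (x + m + \<zeta>' z + t) / ((x + m + \<zeta>' z + t)\<^sup>2 + \<xi>' z)"
      \<comment> \<open>Halving \<epsilon> keeps the three sample points strictly inside the open
        square.\<close>
      if "t \<in> {0, \<epsilon> / 2, - (\<epsilon> / 2)}" for t
    proof -
      have "\<bar>t\<bar> < \<epsilon>"
        using that \<epsilon>(1) by auto
      note Ft = Ft[OF this]
      have t: "F (x + t, y) = (x + m + t, z)"
        using Ft(1) by (simp add: z_def)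
      have "(x + m + t, z) \<in> U'" "\<phi>' (x + m + t, z) = \<phi> (x + t, y)"
        using FU[OF Ft(2)] F(4)[OF Ft(2)] unfolding t .
      then show ?thesis
        using form(1,2)[OF Ft(2)] form'(1,2)[of "x + m + t" z] by (simp add: add_ac)
    qed
    have "\<epsilon> / 2 \<noteq> 0"
      using \<epsilon>(1) by simp
    note general_form_rigid[OF this eq]
    then show "x + \<zeta> y = fst (F (x, y)) + \<zeta>' (snd (F (x, y)))" "\<xi> y = \<xi>' (snd (F (x, y)))"
      using m[OF xy] by (simp_all add: z_def)
  qed
  have "b' (F u) = b u" if "u \<in> U" for u
  proof -
    obtain x y where u: "u = (x, y)" by (rule prod.exhaust)
    obtain x' y' where Fu: "F u = (x', y')" by (rule prod.exhaust)
    have "x + \<zeta> y = x' + \<zeta>' y'" "\<xi> y = \<xi>' y'"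
      using rigid[of x y] that Fu by (simp_all add: u)
    then show ?thesis
      using form(3)[of x y] form'(3)[of x' y'] that FU[OF that] F(4)[OF that]
      unfolding Fu by (simp add: u)
  qed
  from transition_is_translation[OF F(1,2,5,6) this]
  obtain m k where mk: "\<And>x y. (x, y) \<in> U \<Longrightarrow> F (x, y) = (x + m, y + k)"
    by blast
  have "\<zeta>' (y + k) = \<zeta> y + - m" "\<xi>' (y + k) = \<xi> y" if "(x, y) \<in> U" for x y
    using rigid[OF that] mk[OF that] by simp_all
  then show ?thesis
    using translation_projection[OF F(3) mk] by (intro exI[of _ k] exI[of _ "- m"]) auto
qed

theorem theorem1p3:
  fixes \<Sigma> :: "heis set"
  assumes "p_minimal \<Sigma>"
  shows "
    (special_type_I \<Sigma> \<longrightarrow>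
       (\<forall>W e\<^sub>1. characteristic_field \<Sigma> W e\<^sub>1 \<longrightarrow> (\<forall>p\<in>W. \<exists>U \<phi> a b \<zeta>\<^sub>1.
          p \<in> \<phi> ` U \<and> \<phi> ` U \<subseteq> W \<and> normal_coords_I \<Sigma> e\<^sub>1 U \<phi> a b \<zeta>\<^sub>1)) \<and>
       (\<forall>e\<^sub>1 U \<phi> a b \<zeta>\<^sub>1 U' \<phi>' a' b' \<zeta>\<^sub>1'.
          normal_coords_I \<Sigma> e\<^sub>1 U \<phi> a b \<zeta>\<^sub>1 \<and>
          normal_coords_I \<Sigma> e\<^sub>1 U' \<phi>' a' b' \<zeta>\<^sub>1' \<and>
          \<phi> ` U = \<phi>' ` U' \<and> connected (\<phi> ` U) \<longrightarrow>
          (\<exists>k m. snd ` U' = (\<lambda>y. y + k) ` snd ` U \<and>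
             (\<forall>y\<in>snd ` U. \<zeta>\<^sub>1' (y + k) = \<zeta>\<^sub>1 y + m)))) \<and>
    (special_type_II \<Sigma> \<longrightarrow>
       (\<forall>W e\<^sub>1. characteristic_field \<Sigma> W e\<^sub>1 \<longrightarrow> (\<forall>p\<in>W. \<exists>U \<phi> a b \<zeta>\<^sub>1.
          p \<in> \<phi> ` U \<and> \<phi> ` U \<subseteq> W \<and> normal_coords_II \<Sigma> e\<^sub>1 U \<phi> a b \<zeta>\<^sub>1)) \<and>
       (\<forall>e\<^sub>1 U \<phi> a b \<zeta>\<^sub>1 U' \<phi>' a' b' \<zeta>\<^sub>1'.
          normal_coords_II \<Sigma> e\<^sub>1 U \<phi> a b \<zeta>\<^sub>1 \<and>
          normal_coords_II \<Sigma> e\<^sub>1 U' \<phi>' a' b' \<zeta>\<^sub>1' \<and>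
          \<phi> ` U = \<phi>' ` U' \<and> connected (\<phi> ` U) \<longrightarrow>
          (\<exists>k m. snd ` U' = (\<lambda>y. y + k) ` snd ` U \<and>
             (\<forall>y\<in>snd ` U. \<zeta>\<^sub>1' (y + k) = \<zeta>\<^sub>1 y + m)))) \<and>
    (general_type \<Sigma> \<longrightarrow>
       (\<forall>W e\<^sub>1. characteristic_field \<Sigma> W e\<^sub>1 \<longrightarrow> (\<forall>p\<in>W. \<exists>U \<phi> a b \<zeta>\<^sub>1 \<zeta>\<^sub>2.
          p \<in> \<phi> ` U \<and> \<phi> ` U \<subseteq> W \<and> normal_coords_general \<Sigma> e\<^sub>1 U \<phi> a b \<zeta>\<^sub>1 \<zeta>\<^sub>2)) \<and>
       (\<forall>e\<^sub>1 U \<phi> a b \<zeta>\<^sub>1 \<zeta>\<^sub>2 U' \<phi>' a' b' \<zeta>\<^sub>1' \<zeta>\<^sub>2'.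
          normal_coords_general \<Sigma> e\<^sub>1 U \<phi> a b \<zeta>\<^sub>1 \<zeta>\<^sub>2 \<and>
          normal_coords_general \<Sigma> e\<^sub>1 U' \<phi>' a' b' \<zeta>\<^sub>1' \<zeta>\<^sub>2' \<and>
          \<phi> ` U = \<phi>' ` U' \<and> connected (\<phi> ` U) \<longrightarrow>
          (\<exists>k m. snd ` U' = (\<lambda>y. y + k) ` snd ` U \<and>
             (\<forall>y\<in>snd ` U. \<zeta>\<^sub>1' (y + k) = \<zeta>\<^sub>1 y + m \<and> \<zeta>\<^sub>2' (y + k) = \<zeta>\<^sub>2 y))))"
proof (intro conjI impI allI ballI; (elim conjE)?)
  show "\<exists>U \<phi> a b \<zeta>\<^sub>1. p \<in> \<phi> ` U \<and> \<phi> ` U \<subseteq> W \<and> normal_coords_I \<Sigma> e\<^sub>1 U \<phi> a b \<zeta>\<^sub>1"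
    if "special_type_I \<Sigma>" "characteristic_field \<Sigma> W e\<^sub>1" "p \<in> W" for W e\<^sub>1 p
    by (rule normal_coords_I_exist[OF assms that])
  show "\<exists>U \<phi> a b \<zeta>\<^sub>1. p \<in> \<phi> ` U \<and> \<phi> ` U \<subseteq> W \<and> normal_coords_II \<Sigma> e\<^sub>1 U \<phi> a b \<zeta>\<^sub>1"
    if "special_type_II \<Sigma>" "characteristic_field \<Sigma> W e\<^sub>1" "p \<in> W" for W e\<^sub>1 p
    by (rule normal_coords_II_exist[OF assms that])
  show "\<exists>U \<phi> a b \<zeta>\<^sub>1 \<zeta>\<^sub>2. p \<in> \<phi> ` U \<and> \<phi> ` U \<subseteq> W \<and> normal_coords_general \<Sigma> e\<^sub>1 U \<phi> a b \<zeta>\<^sub>1 \<zeta>\<^sub>2"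
    if "general_type \<Sigma>" "characteristic_field \<Sigma> W e\<^sub>1" "p \<in> W" for W e\<^sub>1 p
    by (rule normal_coords_general_exist[OF assms that])
qed (erule (3) normal_coords_I_unique normal_coords_II_unique normal_coords_general_unique)+

end
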